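(* Let $1 \le p \le \infty$ and $n \ge 1$. Let $(k_j)_{j\ge 0}$ be a base sequence and $M=(M_j)_{j \ge 0}$ a weight sequence such that $m_{k_{j+1}}/m_{k_j}$ is bounded in $j$, where $m_j := M_j^{1/j}$. Then, both for $[\cdot]=\{\cdot\}$ and for $[\cdot]=(\cdot)$: (a) $\mathcal{B}^{[M]}_{L^p,(k_j)}(\mathbb{R}^n)= \mathcal{B}^{[M]}_{L^p}(\mathbb{R}^n)$. (b) $\mathcal{D}^{[M]}_{(k_j)}(\mathbb{R}^n)= \mathcal{D}^{[M]}(\mathbb{R}^n)$. Suppose in addition that $(k_j)$ is a special base sequence and let $U \subseteq \mathbb{R}^n$ be open. Then: (c) $\mathcal{E}^{\{M\}}_{L^p,(k_j)}(U)= \mathcal{E}^{\{M\}}_{L^p}(U)$ provided that $j/m_j$ is bounded. (d) $\mathcal{E}^{(M)}_{L^p,(k_j)}(U)= \mathcal{E}^{(M)}_{L^p}(U)$ provided that $j/m_j \to 0$ as $j\to\infty$.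
   Context: A base sequence is a strictly increasing infinite sequence $0 = k_0 < k_1 < k_2 < \cdots$ of integers; it is called special if $k_{j+1}/k_j$, $j \ge 1$, is bounded. A weight sequence is a positive sequence $M=(M_k)_{k\ge 0}$ with $M_0=1\le M_1 \le \mu_2 \le \mu_3 \le \cdots$, where $\mu_k:= M_k/M_{k-1}$. We put $m_k:= M_k^{1/k}$ for $k\ge 1$ and $m_0:=1$ (so that $(\rho m_k)^k=\rho^k M_k$ for all $k \ge 0$). For $U \subseteq \mathbb{R}^n$ open, $\mathcal{E}^{\{M\}}_{L^p}(U)$ (resp. $\mathcal{E}^{(M)}_{L^p}(U)$) is the set of all $f \in C^\infty(U)$ such that for all open relatively compact $\Omega \Subset U$ there exist $C,\rho>0$ (resp. for all open relatively compact $\Omega\Subset U$ and all $\rho>0$ there exists $C>0$) with $$\max_{|\alpha|=k} \|\partial^{\alpha}f\|_{L^p(\Omega)} \le C (\rho m_{k})^{k} \quad \text{for all } k \ge 0.$$ $\mathcal{B}^{\{M\}}_{L^p}(\mathbb{R}^n)$ (resp. $\mathcal{B}^{(M)}_{L^p}(\mathbb{R}^n)$) is the set of all $f \in C^\infty(\mathbb{R}^n)$ such that there exist $C,\rho>0$ (resp. for all $\rho>0$ there exists $C>0$) with $\|\partial^{\alpha}f\|_{L^p(\mathbb{R}^n)} \le C (\rho m_{|\alpha|})^{|\alpha|}$ for all multiindices $\alpha\in \mathbb{N}^n$. $\mathcal{D}^{[M]}(\mathbb{R}^n) := \mathcal{B}^{[M]}_{L^\infty}(\mathbb{R}^n) \cap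 C^\infty_c(\mathbb{R}^n)$. $\mathcal{E}^{[M]}_{L^p,(k_j)}(U)$, $\mathcal{B}^{[M]}_{L^p,(k_j)}(\mathbb{R}^n)$, $\mathcal{D}^{[M]}_{(k_j)}(\mathbb{R}^n)$ are the sets of $C^\infty$ functions (with compact support in the case of $\mathcal{D}$) satisfying the respective defining estimates only for multiindices $\alpha$ with $|\alpha| \in\{ k_j : j \ge 0\}$. *)

theory Defs
  imports "HOL-Analysis.Analysis" "HOL-Probability.Essential_Supremum"
begin

definition base_sequence :: "(nat \<Rightarrow> nat) \<Rightarrow> bool" where
  "base_sequence k \<longleftrightarrow> k 0 = 0 \<and> strict_mono k"

definition special_base_sequence :: "(nat \<Rightarrow> nat) \<Rightarrow> bool" where
  "special_base_sequence k \<longleftrightarrow>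
     base_sequence k \<and> bdd_above ((\<lambda>j. real (k (Suc j)) / real (k j)) ` {1..})"

definition weight_quotient :: "(nat \<Rightarrow> real) \<Rightarrow> nat \<Rightarrow> real" where
  "weight_quotient M k = M k / M (k - 1)"

text \<open>The last three conjuncts say \<open>M\<^sub>0 = 1 \<le> M\<^sub>1 \<le> \<mu>\<^sub>2 \<le> \<mu>\<^sub>3 \<le> \<dots>\<close>, since \<open>\<mu>\<^sub>1 = M\<^sub>1\<close>.\<close>

definition weight_sequence :: "(nat \<Rightarrow> real) \<Rightarrow> bool" where
  "weight_sequence M \<longleftrightarrow> (\<forall>k. M k > 0) \<and> M 0 = 1 \<and> 1 \<le> M 1 \<and>
     (\<forall>k\<ge>1. weight_quotient M k \<le> weight_quotient M (Suc k))"

definition weight_root :: "(nat \<Rightarrow> real) \<Rightarrow> nat \<Rightarrow> real" where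
  "weight_root M k = (if k = 0 then 1 else M k powr (1 / real k))"

text \<open>
  Functions on an open set \<open>S\<close> are represented by total functions whose values outside \<open>S\<close> are
  irrelevant: for open \<open>S\<close>, neither smoothness on \<open>S\<close> nor the derivatives at points of \<open>S\<close> depend
  on them.
\<close>

primrec higher_differentiable_on ::
    "'a::real_normed_vector set \<Rightarrow> ('a \<Rightarrow> 'b::real_normed_vector) \<Rightarrow> nat \<Rightarrow> bool" where
  "higher_differentiable_on S f 0 \<longleftrightarrow> continuous_on S f"
| "higher_differentiable_on S f (Suc n) \<longleftrightarrow>
     (\<forall>x\<in>S. f differentiable (at x)) \<and>
     (\<forall>v. higher_differentiable_on S (\<lambda>x. frechet_derivative f (at x) v) n)"

definition smooth_on :: "'a::real_normed_vector set \<Rightarrow> ('a \<Rightarrow> 'b::real_normed_vector) \<Rightarrow> bool" where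
  "smooth_on S f \<longleftrightarrow> (\<forall>n. higher_differentiable_on S f n)"

definition partial_deriv ::
    "'n::finite \<Rightarrow> (real^'n \<Rightarrow> 'b::real_normed_vector) \<Rightarrow> real^'n \<Rightarrow> 'b" where
  "partial_deriv i f = (\<lambda>x. frechet_derivative f (at x) (axis i 1))"

text \<open>
  Multiindices are elements of \<open>nat^'n\<close>. The index type carries no order, so \<open>\<partial>\<^sup>\<alpha>\<close> is composed along
  a fixed arbitrary enumeration of the coordinates; for smooth functions the order is immaterial.
\<close>

definition coordinates :: "'n::finite list" where
  "coordinates = (SOME xs. distinct xs \<and> set xs = UNIV)"

definition mi_order :: "nat^'n::finite \<Rightarrow> nat" where
  "mi_order \<alpha> = (\<Sum>i\<in>UNIV. \<alpha> $ i)"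

definition mi_deriv ::
    "nat^'n::finite \<Rightarrow> (real^'n \<Rightarrow> 'b::real_normed_vector) \<Rightarrow> real^'n \<Rightarrow> 'b" where
  "mi_deriv \<alpha> f = foldr (\<lambda>i. partial_deriv i ^^ (\<alpha> $ i)) coordinates f"

definition Lp_norm ::
    "ennreal \<Rightarrow> 'a::euclidean_space set \<Rightarrow> ('a \<Rightarrow> 'b::real_normed_vector) \<Rightarrow> ennreal" where
  "Lp_norm p S g =
     (if p = \<infinity> then esssup (lebesgue_on S) (\<lambda>x. ennreal (norm (g x)))
      else let I = (\<integral>\<^sup>+ x. ennreal (norm (g x) powr enn2real p) \<partial>lebesgue_on S)
           in if I = \<infinity> then \<infinity> else ennreal (enn2real I powr (1 / enn2real p)))"

text \<open>\<open>Roumieu\<close> is the case \<open>{\<cdot>}\<close>, \<open>Beurling\<close> the case \<open>(\<cdot>)\<close>.\<close>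

datatype dc_type = Roumieu | Beurling

fun dc_bound :: "dc_type \<Rightarrow> (real \<Rightarrow> real \<Rightarrow> bool) \<Rightarrow> bool" where
  "dc_bound Roumieu P \<longleftrightarrow> (\<exists>C>0. \<exists>\<rho>>0. P C \<rho>)"
| "dc_bound Beurling P \<longleftrightarrow> (\<forall>\<rho>>0. \<exists>C>0. P C \<rho>)"

text \<open>
  In the following definitions the argument \<open>K\<close> is the set of those orders \<open>|\<alpha>|\<close> for which the
  defining estimates are required.
\<close>

definition E_class_on ::
    "nat set \<Rightarrow> dc_type \<Rightarrow> (nat \<Rightarrow> real) \<Rightarrow> ennreal \<Rightarrow> (real^'n::finite) set \<Rightarrow> (real^'n \<Rightarrow> complex) set" where
  "E_class_on K t M p U =
     {f. smooth_on U f \<and>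
         (\<forall>\<Omega>. open \<Omega> \<and> compact (closure \<Omega>) \<and> closure \<Omega> \<subseteq> U \<longrightarrow>
            dc_bound t (\<lambda>C \<rho>. \<forall>k\<in>K.
              Max {Lp_norm p \<Omega> (mi_deriv \<alpha> f) | \<alpha>. mi_order \<alpha> = k}
                \<le> ennreal (C * (\<rho> * weight_root M k) ^ k)))}"

definition B_class_on ::
    "nat set \<Rightarrow> dc_type \<Rightarrow> (nat \<Rightarrow> real) \<Rightarrow> ennreal \<Rightarrow> (real^'n::finite \<Rightarrow> complex) set" where
  "B_class_on K t M p =
     {f. smooth_on UNIV f \<and>
         dc_bound t (\<lambda>C \<rho>. \<forall>\<alpha>. mi_order \<alpha> \<in> K \<longrightarrow>
           Lp_norm p UNIV (mi_deriv \<alpha> f)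
             \<le> ennreal (C * (\<rho> * weight_root M (mi_order \<alpha>)) ^ mi_order \<alpha>))}"

definition D_class_on ::
    "nat set \<Rightarrow> dc_type \<Rightarrow> (nat \<Rightarrow> real) \<Rightarrow> (real^'n::finite \<Rightarrow> complex) set" where
  "D_class_on K t M = B_class_on K t M \<infinity> \<inter> {f. smooth_on UNIV f \<and> compact (closure {x. f x \<noteq> 0})}"

abbreviation E_class ::
    "dc_type \<Rightarrow> (nat \<Rightarrow> real) \<Rightarrow> ennreal \<Rightarrow> (real^'n::finite) set \<Rightarrow> (real^'n \<Rightarrow> complex) set" where
  "E_class \<equiv> E_class_on UNIV"

abbreviation B_class ::
    "dc_type \<Rightarrow> (nat \<Rightarrow> real) \<Rightarrow> ennreal \<Rightarrow> (real^'n::finite \<Rightarrow> complex) set" where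
  "B_class \<equiv> B_class_on UNIV"

abbreviation D_class :: "dc_type \<Rightarrow> (nat \<Rightarrow> real) \<Rightarrow> (real^'n::finite \<Rightarrow> complex) set" where
  "D_class \<equiv> D_class_on UNIV"

end

theory Submission
  imports Defs
begin

text \<open>
  Only one inclusion is in question: bounds for the derivatives whose order is some \<open>k
  j\<close> have to be carried over to an order \<open>q\<close> with \<open>k j \<le> q < k
  (j + 1)\<close>. Write \<open>A\<^sub>l\<close> for the largest norm of a partial derivative
  of order \<open>l\<close>, and \<open>m\<close> for the root of order \<open>k j\<close> of
  the weight. Since consecutive roots along the base sequence have bounded ratio
  \<open>H\<close>, one number \<open>S = H \<rho> m\<close> satisfies \<open>A\<^sub>l \<le>
  C S\<^sup>l\<close> at both ends \<open>l = k j\<close> and \<open>l = k (j + 1)\<close>. It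
  is enough to find \<open>A\<^sub>q \<le> C E\<^sup>q S\<^sup>q\<close> with a constant
  \<open>E\<close> independent of \<open>j\<close> and \<open>q\<close>, because the roots of
  the weight increase.

  On the whole space this is an inequality of Landau--Kolmogorov type,
  \<open>\<parallel>\<partial>\<^sub>v F\<parallel> \<le> 18 \<parallel>F\<parallel> + 2
  \<parallel>\<partial>\<^sub>v\<^sup>N F\<parallel>\<close> (lemma
  \<open>Lp_le_dir_deriv\<close>), applied to \<open>v = e / S\<close> and repeated \<open>q -
  k j\<close> times. Gaps in the base sequence may be arbitrarily long compared with
  \<open>q\<close>, so it is essential that the constants do not depend on \<open>N\<close>.
  They come from averaging a central difference of order \<open>N - 2\<close> of the second
  derivative over its step size \<open>h\<close>: the value at the centre, which carries the
  largest binomial coefficient, is unaffected, while every other term loses its two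
  derivatives and gains a factor \<open>1 / j\<^sup>2\<close>, which is summable (lemma
  \<open>second_derivative_eq_differences\<close>).

  On a relatively compact set such an iteration would move points too far, because every step
  uses translates of total length \<open>N / S\<close>. There the truncated series \<open>D =
  log (1 + \<Delta>)\<close> is used instead (lemma
  \<open>deriv_eq_log_series_differences\<close>): it trades derivatives for differences and
  keeps the total displacement at most \<open>N / S\<close> for all pure derivatives of order
  up to \<open>N\<close> at once (lemma \<open>Lp_le_idiff_iterated_deriv\<close>). The price
  is a constant \<open>8\<^sup>N\<close>. For special base sequences it is harmless, since
  \<open>k (j + 1)\<close> is at most a multiple of \<open>q\<close>, and the restriction on
  the displacement, that \<open>S\<close> be at least a multiple of \<open>q\<close>, is what
  the hypothesis on \<open>j / m\<close> provides. Mixed derivatives are treated one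
  coordinate at a time on a chain of growing domains.

  Both inequalities hold in every \<open>L\<^sup>p\<close> because they use only translations,
  finite sums and averages, for which Minkowski's inequality is available (lemmas
  \<open>Lp_le_add\<close> and \<open>Lp_le_integral\<close>).
\<close>

section \<open>Directional derivatives of smooth functions\<close>

definition dir_deriv ::
    "'a::real_normed_vector \<Rightarrow> ('a \<Rightarrow> 'b::real_normed_vector) \<Rightarrow> 'a \<Rightarrow> 'b" where
  "dir_deriv v f = (\<lambda>x. frechet_derivative f (at x) v)"

lemma partial_deriv_eq_dir_deriv: "partial_deriv i = dir_deriv (axis i 1)"
  by (simp add: fun_eq_iff partial_deriv_def dir_deriv_def)

lemma smooth_on_dir_deriv: "smooth_on U f \<Longrightarrow> smooth_on U (dir_deriv v f)"
  unfolding smooth_on_def dir_deriv_def by (metis higher_differentiable_on.simps(2))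

lemma smooth_on_imp_continuous_on: "smooth_on U f \<Longrightarrow> continuous_on U f"
  unfolding smooth_on_def by (metis higher_differentiable_on.simps(1))

lemma smooth_on_imp_has_derivative:
  assumes "smooth_on U f" "x \<in> U"
  shows "(f has_derivative (\<lambda>v. dir_deriv v f x)) (at x)"
proof -
  have "f differentiable (at x)"
    using assms unfolding smooth_on_def by (metis higher_differentiable_on.simps(2))
  then show ?thesis
    unfolding dir_deriv_def using frechet_derivative_works by blast
qed

lemma dir_deriv_eqI:
  assumes "(f has_derivative f') (at x)" shows "dir_deriv v f x = f' v"
  using frechet_derivative_at[OF assms] by (simp add: dir_deriv_def)

lemma dir_deriv_cong_on:
  assumes "open U" "smooth_on U f" "\<And>y. y \<in> U \<Longrightarrow> g y = f y" "x \<in> U"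
  shows "dir_deriv v g x = dir_deriv v f x"
proof -
  have "(g has_derivative (\<lambda>v. dir_deriv v f x)) (at x)"
    by (rule has_derivative_transform_within_open[OF smooth_on_imp_has_derivative[OF assms(2,4)] assms(1,4)])
       (simp add: assms(3))
  then show ?thesis by (rule dir_deriv_eqI)
qed

lemma smooth_on_iterated_dir_deriv: "smooth_on U f \<Longrightarrow> smooth_on U ((dir_deriv v ^^ i) f)"
  by (induction i) (auto intro: smooth_on_dir_deriv)

lemma smooth_on_foldr_dir_deriv: "smooth_on U f \<Longrightarrow> smooth_on U (foldr dir_deriv vs f)"
  by (induction vs) (auto intro: smooth_on_dir_deriv)

lemma has_vector_derivative_along_line:
  assumes "smooth_on U f" "x + t *\<^sub>R v \<in> U"
  shows "((\<lambda>t. f (x + t *\<^sub>R v)) has_vector_derivative dir_deriv v f (x + t *\<^sub>R v)) (at t)"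
proof -
  let ?D = "\<lambda>w. dir_deriv w f (x + t *\<^sub>R v)"
  have 1: "((\<lambda>t. x + t *\<^sub>R v) has_derivative (\<lambda>s. s *\<^sub>R v)) (at t)"
    by (auto intro!: derivative_eq_intros)
  have 2: "(f has_derivative ?D) (at (x + t *\<^sub>R v))"
    by (rule smooth_on_imp_has_derivative[OF assms])
  have "((\<lambda>t. f (x + t *\<^sub>R v)) has_derivative (\<lambda>s. ?D (s *\<^sub>R v))) (at t)"
    using has_derivative_compose[OF 1 2] by simp
  moreover have "?D (s *\<^sub>R v) = s *\<^sub>R ?D v" for s
    using linear_scale[OF has_derivative_linear[OF 2]] by blast
  ultimately show ?thesis by (simp add: has_vector_derivative_def)
qed

text \<open>
  Rescaling the direction is how the interpolation parameter enters: the inequalities below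
  are proved for an arbitrary vector \<open>v\<close> at unit scale and are then applied to
  \<open>v = e / S\<close>.
\<close>
lemma iterated_dir_deriv_scaleR:
  assumes "open U" "smooth_on U f" "x \<in> U"
  shows "(dir_deriv (c *\<^sub>R v) ^^ i) f x = c ^ i *\<^sub>R (dir_deriv v ^^ i) f x"
  using assms(3)
proof (induction i arbitrary: x)
  case (Suc i)
  let ?g = "(dir_deriv v ^^ i) f"
  have g: "(?g has_derivative (\<lambda>w. dir_deriv w ?g x)) (at x)"
    by (rule smooth_on_imp_has_derivative[OF smooth_on_iterated_dir_deriv[OF assms(2)] Suc.prems])
  have "((\<lambda>y. c ^ i *\<^sub>R ?g y) has_derivative (\<lambda>w. c ^ i *\<^sub>R dir_deriv w ?g x)) (at x)"
    by (intro derivative_intros g)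
  then have "((dir_deriv (c *\<^sub>R v) ^^ i) f has_derivative (\<lambda>w. c ^ i *\<^sub>R dir_deriv w ?g x)) (at x)"
    by (rule has_derivative_transform_within_open[OF _ assms(1) Suc.prems]) (simp add: Suc.IH)
  then have "(dir_deriv (c *\<^sub>R v) ^^ Suc i) f x = c ^ i *\<^sub>R dir_deriv (c *\<^sub>R v) ?g x"
    by (simp add: dir_deriv_eqI)
  also have "dir_deriv (c *\<^sub>R v) ?g x = c *\<^sub>R dir_deriv v ?g x"
    using linear_scale[OF has_derivative_linear[OF g]] by blast
  finally show ?case by (simp add: mult.commute)
qed simp

text \<open>
  The mean value inequality for \<open>s \<mapsto> g s - s c\<close>.
\<close>
lemma segment_increment_bound:
  fixes g :: "real \<Rightarrow> 'b::real_normed_vector"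
  assumes "\<And>s. s \<in> {0..t} \<Longrightarrow> (g has_vector_derivative g' s) (at s)"
    and "\<And>s. s \<in> {0..t} \<Longrightarrow> norm (g' s - c) \<le> B" and "0 \<le> t"
  shows "norm (g t - g 0 - t *\<^sub>R c) \<le> t * B"
proof -
  have d: "((\<lambda>s. g s - s *\<^sub>R c) has_derivative (\<lambda>h. h *\<^sub>R (g' s - c))) (at s within {0..t})"
    if "s \<in> {0..t}" for s
  proof -
    have "((\<lambda>s. g s - s *\<^sub>R c) has_vector_derivative g' s - c) (at s)"
      by (rule derivative_eq_intros assms(1)[OF that] refl | simp)+
    then show ?thesis
      by (simp add: has_vector_derivative_def has_derivative_at_withinI)
  qed
  have "norm ((g t - t *\<^sub>R c) - (g 0 - 0 *\<^sub>R c)) \<le> B * norm (t - 0)"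
    using \<open>0 \<le> t\<close> assms(2)
    by (intro differentiable_bound[OF _ d])
       (auto simp: onorm_scaleR_left onorm_id bounded_linear_ident)
  then show ?thesis using \<open>0 \<le> t\<close> by (simp add: algebra_simps)
qed

text \<open>
  Two applications of the mean value inequality, first along \<open>v\<close> and inside it
  along \<open>w\<close>, compare the second difference with \<open>\<partial>\<^sub>w
  \<partial>\<^sub>v f\<close>. The second difference is symmetric in \<open>v\<close> and
  \<open>w\<close>, which is what makes the mixed derivatives agree in the next lemma.
\<close>
lemma second_difference_approx:
  fixes f :: "'a::real_normed_vector \<Rightarrow> 'b::real_normed_vector"
  assumes "open U" "smooth_on U f" "x \<in> U" "e > 0"
  shows "\<exists>d>0. \<forall>t. 0 < t \<and> t < d \<longrightarrow>
    norm (f (x + t *\<^sub>R w + t *\<^sub>R v) - f (x + t *\<^sub>R w) - f (x + t *\<^sub>R v) + f x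
           - (t * t) *\<^sub>R dir_deriv w (dir_deriv v f) x) \<le> t * t * e"
proof -
  let ?E = "dir_deriv w (dir_deriv v f)"
  have "continuous_on U ?E"
    by (intro smooth_on_imp_continuous_on smooth_on_dir_deriv assms)
  then have "isCont ?E x" using assms by (simp add: continuous_on_eq_continuous_at)
  then obtain r1 where r1: "r1 > 0" "\<And>y. dist y x < r1 \<Longrightarrow> dist (?E y) (?E x) < e"
    using \<open>e > 0\<close> unfolding continuous_at_eps_delta by metis
  obtain r2 where r2: "r2 > 0" "ball x r2 \<subseteq> U"
    using assms(1,3) open_contains_ball by blast
  define r where "r = min r1 r2"
  \<comment> \<open>With this \<open>d\<close> the whole parallelogram with sides \<open>t w\<close>, \<open>t v\<close> stays within distance \<open>r\<close> of \<open>x\<close>.\<close>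
  define d where "d = r / (norm v + norm w + 1)"
  have den: "norm v + norm w + 1 > 0"
    by (metis add_nonneg_nonneg add_nonneg_pos norm_ge_zero zero_less_one)
  have "d > 0" unfolding d_def r_def using r1 r2 den by simp
  have near: "dist (x + s *\<^sub>R w + u *\<^sub>R v) x < r"
    if "t < d" "s \<in> {0..t}" "u \<in> {0..t}" for s t u
  proof -
    have "dist (x + s *\<^sub>R w + u *\<^sub>R v) x = norm (s *\<^sub>R w + u *\<^sub>R v)" by (simp add: dist_norm)
    also have "\<dots> \<le> s * norm w + u * norm v"
      using norm_triangle_ineq[of "s *\<^sub>R w" "u *\<^sub>R v"] that by simp
    also have "\<dots> \<le> t * norm w + t * norm v"
      using that by (intro add_mono mult_right_mono) auto
    also have "\<dots> \<le> t * (norm v + norm w + 1)" using that by (simp add: algebra_simps)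
    also have "\<dots> < d * (norm v + norm w + 1)"
      using that den by (intro mult_strict_right_mono) auto
    also have "\<dots> = r" unfolding d_def using den by simp
    finally show ?thesis .
  qed
  have inU: "x + s *\<^sub>R w + u *\<^sub>R v \<in> U" if "t < d" "s \<in> {0..t}" "u \<in> {0..t}" for s t u
    using near[OF that] r2 by (auto simp: r_def mem_ball dist_commute subset_iff)
  have closeE: "norm (?E (x + s *\<^sub>R w + u *\<^sub>R v) - ?E x) \<le> e"
    if "t < d" "s \<in> {0..t}" "u \<in> {0..t}" for s t u
    using near[OF that] r1(2) by (force simp: r_def dist_norm intro: less_imp_le)
  show ?thesis
  proof (intro exI[of _ d] conjI allI impI, fact \<open>d > 0\<close>)
    fix t assume "0 < t \<and> t < d"
    then have t: "0 < t" "t < d" by auto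
    have inner: "norm (dir_deriv v f (x + t *\<^sub>R w + u *\<^sub>R v) - dir_deriv v f (x + u *\<^sub>R v) - t *\<^sub>R ?E x)
        \<le> t * e" if u: "u \<in> {0..t}" for u
    proof -
      have "((\<lambda>s. dir_deriv v f ((x + u *\<^sub>R v) + s *\<^sub>R w)) has_vector_derivative
          ?E ((x + u *\<^sub>R v) + s *\<^sub>R w)) (at s)" if "s \<in> {0..t}" for s
        using inU[OF t(2) that u]
        by (intro has_vector_derivative_along_line[OF smooth_on_dir_deriv[OF assms(2)]])
           (simp add: algebra_simps)
      from segment_increment_bound[OF this, of t "?E x" e] closeE[OF t(2) _ u] t show ?thesis
        by (simp add: algebra_simps)
    qed
    have "((\<lambda>u. f ((x + t *\<^sub>R w) + u *\<^sub>R v) - f (x + u *\<^sub>R v)) has_vector_derivative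
          dir_deriv v f ((x + t *\<^sub>R w) + u *\<^sub>R v) - dir_deriv v f (x + u *\<^sub>R v)) (at u)"
      if "u \<in> {0..t}" for u
      using inU[OF t(2) _ that, of t] inU[OF t(2) _ that, of 0] t
      by (intro derivative_intros has_vector_derivative_along_line[OF assms(2)]) auto
    from segment_increment_bound[OF this, of t "t *\<^sub>R ?E x" "t * e"] inner t
    show "norm (f (x + t *\<^sub>R w + t *\<^sub>R v) - f (x + t *\<^sub>R w) - f (x + t *\<^sub>R v) + f x
           - (t * t) *\<^sub>R ?E x) \<le> t * t * e"
      by (simp add: algebra_simps)
  qed
qed

lemma dir_deriv_commute:
  fixes f :: "'a::real_normed_vector \<Rightarrow> 'b::real_normed_vector"
  assumes "open U" "smooth_on U f" "x \<in> U"
  shows "dir_deriv w (dir_deriv v f) x = dir_deriv v (dir_deriv w f) x"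
proof -
  let ?A = "dir_deriv w (dir_deriv v f) x" and ?B = "dir_deriv v (dir_deriv w f) x"
  have "norm (?A - ?B) \<le> 0 + e" if "e > 0" for e
  proof -
    from that have "e / 2 > 0" by simp
    obtain d1 where d1: "d1 > 0" "\<And>t. 0 < t \<Longrightarrow> t < d1 \<Longrightarrow>
      norm (f (x + t *\<^sub>R w + t *\<^sub>R v) - f (x + t *\<^sub>R w) - f (x + t *\<^sub>R v) + f x
           - (t * t) *\<^sub>R ?A) \<le> t * t * (e / 2)"
      using second_difference_approx[OF assms \<open>e / 2 > 0\<close>, of w v] by blast
    obtain d2 where d2: "d2 > 0" "\<And>t. 0 < t \<Longrightarrow> t < d2 \<Longrightarrow>
      norm (f (x + t *\<^sub>R v + t *\<^sub>R w) - f (x + t *\<^sub>R v) - f (x + t *\<^sub>R w) + f x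
           - (t * t) *\<^sub>R ?B) \<le> t * t * (e / 2)"
      using second_difference_approx[OF assms \<open>e / 2 > 0\<close>, of v w] by blast
    define t where "t = min d1 d2 / 2"
    have t: "0 < t" "t < d1" "t < d2" using d1 d2 by (auto simp: t_def)
    let ?Q = "f (x + t *\<^sub>R w + t *\<^sub>R v) - f (x + t *\<^sub>R w) - f (x + t *\<^sub>R v) + f x"
    have "norm (?Q - (t * t) *\<^sub>R ?A) \<le> t * t * (e / 2)" using d1 t by blast
    moreover have "norm (?Q - (t * t) *\<^sub>R ?B) \<le> t * t * (e / 2)"
      using d2(2)[of t] t by (simp add: algebra_simps)
    ultimately have "norm ((?Q - (t * t) *\<^sub>R ?B) - (?Q - (t * t) *\<^sub>R ?A)) \<le> t * t * e"
      by (intro order_trans[OF norm_triangle_ineq4]) simp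
    then have "norm ((t * t) *\<^sub>R (?A - ?B)) \<le> t * t * e"
      by (simp add: algebra_simps)
    then show ?thesis using t by simp
  qed
  then have "norm (?A - ?B) \<le> 0" by (rule field_le_epsilon)
  then show ?thesis by simp
qed

lemma foldr_dir_deriv_move:
  assumes "open U" "smooth_on U f" "x \<in> U"
  shows "foldr dir_deriv (us @ v # vs) f x = foldr dir_deriv (v # us @ vs) f x"
  using assms(3)
proof (induction us arbitrary: x)
  case (Cons u us)
  have sm: "smooth_on U (foldr dir_deriv ws f)" for ws
    by (rule smooth_on_foldr_dir_deriv[OF assms(2)])
  have "foldr dir_deriv ((u # us) @ v # vs) f x = dir_deriv u (foldr dir_deriv (us @ v # vs) f) x"
    by simp
  also have "\<dots> = dir_deriv u (foldr dir_deriv (v # us @ vs) f) x"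
    by (rule dir_deriv_cong_on[OF assms(1) sm]) (use Cons in auto)
  also have "\<dots> = dir_deriv v (dir_deriv u (foldr dir_deriv (us @ vs) f)) x"
    using dir_deriv_commute[OF assms(1) sm Cons.prems, of u v "us @ vs"] by simp
  finally show ?case by simp
qed simp

text \<open>
  A mixed derivative is determined by the multiset of its directions. This lets a derivative
  be written in whatever order suits an estimate, although
  \<open>\<partial>\<^sup>\<alpha>\<close> is defined with one fixed order.
\<close>
lemma foldr_dir_deriv_mset_eq:
  assumes "open U" "smooth_on U f" "mset vs = mset ws" "x \<in> U"
  shows "foldr dir_deriv vs f x = foldr dir_deriv ws f x"
  using assms(3,4)
proof (induction vs arbitrary: ws x)
  case (Cons v vs)
  then have "v \<in> set ws" by (metis list.set_intros(1) mset_eq_setD)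
  then obtain as bs where ws: "ws = as @ v # bs" by (meson split_list)
  with Cons.prems have m: "mset vs = mset (as @ bs)" by simp
  have "foldr dir_deriv (v # vs) f x = dir_deriv v (foldr dir_deriv (as @ bs) f) x"
    using dir_deriv_cong_on[OF assms(1) smooth_on_foldr_dir_deriv[OF assms(2)] Cons.IH[OF m] Cons.prems(2)]
    by simp
  also have "\<dots> = foldr dir_deriv ws f x"
    using foldr_dir_deriv_move[OF assms(1,2) Cons.prems(2), of as v bs] by (simp add: ws)
  finally show ?case .
qed simp

section \<open>Bounds in Lebesgue norms\<close>

text \<open>
  A form of \<open>\<parallel>g\<parallel> \<le> B\<close> in \<open>L\<^sup>p(W)\<close> with
  a real bound and without roots or null sets. It is meant for continuous \<open>g\<close> on
  open \<open>W\<close>, where it agrees with the bound on the norm. Bounds are kept positive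
  rather than nonnegative: Minkowski's inequality can then be read off from convexity after
  dividing by them.
\<close>
definition Lp_le ::
    "ennreal \<Rightarrow> 'a::euclidean_space set \<Rightarrow> ('a \<Rightarrow> 'b::real_normed_vector) \<Rightarrow> real \<Rightarrow> bool" where
  "Lp_le p W g B \<longleftrightarrow>
     (if p = \<infinity> then \<forall>x\<in>W. norm (g x) \<le> B
      else (\<integral>\<^sup>+x\<in>W. ennreal (norm (g x) powr enn2real p) \<partial>lborel) \<le> ennreal (B powr enn2real p))"

lemma enn2real_ge_1: "1 \<le> p \<Longrightarrow> p \<noteq> \<infinity> \<Longrightarrow> 1 \<le> enn2real p"
  using enn2real_mono[of 1 p] by (simp add: top.not_eq_extremum)

lemma measurable_norm_powr_indicator:
  assumes "W \<in> sets borel" "continuous_on W g" "q > 0"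
  shows "(\<lambda>x. ennreal (norm (g x) powr q) * indicator W x) \<in> borel_measurable borel"
proof -
  have "continuous_on W (\<lambda>x. norm (g x) powr q)"
    using assms(2,3) by (intro continuous_on_powr' continuous_intros) auto
  from borel_measurable_continuous_on_indicator[OF assms(1) this]
  have "(\<lambda>x. ennreal (indicator W x *\<^sub>R (norm (g x) powr q))) \<in> borel_measurable borel"
    by measurable
  also have "(\<lambda>x. ennreal (indicator W x *\<^sub>R (norm (g x) powr q))) =
      (\<lambda>x. ennreal (norm (g x) powr q) * indicator W x)"
    by (auto simp: fun_eq_iff indicator_def)
  finally show ?thesis .
qed

text \<open>
  Nonempty open sets have positive measure, so for continuous functions an essential bound is
  a pointwise one.
\<close>
lemma AE_le_imp_le_on_open:
  fixes f :: "'a::euclidean_space \<Rightarrow> real"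
  assumes "open W" "continuous_on W f" "AE x in lborel. x \<in> W \<longrightarrow> f x \<le> B" "x \<in> W"
  shows "f x \<le> B"
proof (rule ccontr)
  define V where "V = W \<inter> f -` {B<..}"
  assume "\<not> f x \<le> B"
  then have "x \<in> V" using assms(4) by (auto simp: V_def)
  moreover have "open V"
    unfolding V_def using assms(1,2) by (auto intro: continuous_open_preimage)
  ultimately obtain r where r: "r > 0" "ball x r \<subseteq> V" using open_contains_ball by blast
  have "AE y in lborel. y \<notin> ball x r"
    using assms(3) by eventually_elim (use r in \<open>auto simp: V_def\<close>)
  then have "emeasure lborel (ball x r) = 0"
    by (subst (asm) AE_iff_measurable[where N = "ball x r"]) auto
  then show False
    using r by (simp add: emeasure_ball unit_ball_vol_pos less_imp_le)
      (metis less_numeral_extra(3) unit_ball_vol_pos of_nat_0_le_iff)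
qed

lemma Lp_norm_le_iff:
  fixes g :: "'a::euclidean_space \<Rightarrow> 'b::real_normed_vector"
  assumes "open W" "continuous_on W g" "1 \<le> p" "0 \<le> B"
  shows "Lp_norm p W g \<le> ennreal B \<longleftrightarrow> Lp_le p W g B"
proof -
  have W: "W \<in> sets lebesgue" "W \<inter> space lebesgue \<in> sets lebesgue" "W \<in> sets borel"
    using assms(1) by auto
  show ?thesis
  proof (cases "p = \<infinity>")
    case True
    have cn: "continuous_on W (\<lambda>x. norm (g x))" using assms(2) by (intro continuous_intros)
    then have meas: "(\<lambda>x. ennreal (norm (g x))) \<in> borel_measurable (lebesgue_on W)"
      using continuous_imp_measurable_on_sets_lebesgue[OF _ W(1)] by measurable
    have "esssup (lebesgue_on W) (\<lambda>x. ennreal (norm (g x))) \<le> ennreal B \<longleftrightarrow> (\<forall>x\<in>W. norm (g x) \<le> B)"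
    proof
      assume *: "esssup (lebesgue_on W) (\<lambda>x. ennreal (norm (g x))) \<le> ennreal B"
      have "AE x in lebesgue_on W. ennreal (norm (g x)) \<le> ennreal B"
        using esssup_AE[where M = "lebesgue_on W" and f = "\<lambda>x. ennreal (norm (g x))"]
        by eventually_elim (use * in order)
      then have "AE x in lborel. x \<in> W \<longrightarrow> norm (g x) \<le> B"
        using assms(4) by (simp add: AE_restrict_space_iff[OF W(2)] AE_completion_iff)
      then show "\<forall>x\<in>W. norm (g x) \<le> B"
        using AE_le_imp_le_on_open[OF assms(1) cn] by blast
    next
      assume *: "\<forall>x\<in>W. norm (g x) \<le> B"
      then have "AE x in lebesgue_on W. ennreal (norm (g x)) \<le> ennreal B"
        by (intro AE_I2) (auto intro: ennreal_leI)
      then show "esssup (lebesgue_on W) (\<lambda>x. ennreal (norm (g x))) \<le> ennreal B"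
        by (intro esssup_I meas)
    qed
    then show ?thesis by (simp add: Lp_norm_def Lp_le_def True)
  next
    case False
    define q where "q = enn2real p"
    have q: "q \<ge> 1" unfolding q_def by (rule enn2real_ge_1[OF assms(3) False])
    define I where "I = (\<integral>\<^sup>+x\<in>W. ennreal (norm (g x) powr q) \<partial>lborel)"
    have meas: "(\<lambda>x. ennreal (norm (g x) powr q) * indicator W x) \<in> borel_measurable borel"
      by (rule measurable_norm_powr_indicator[OF W(3) assms(2)]) (use q in auto)
    have I: "(\<integral>\<^sup>+x. ennreal (norm (g x) powr q) \<partial>lebesgue_on W) = I"
      unfolding I_def nn_integral_restrict_space[OF W(2)] by (rule nn_integral_completion)
    have L: "Lp_norm p W g = (if I = \<infinity> then \<infinity> else ennreal (enn2real I powr (1 / q)))"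
      unfolding Lp_norm_def using False by (simp only: q_def[symmetric] I Let_def if_False)
    show ?thesis
    proof (cases "I = \<infinity>")
      case True
      then show ?thesis using False unfolding Lp_le_def
        by (simp only: L q_def[symmetric] I_def[symmetric]) (auto simp: top_unique)
    next
      case fin: False
      then obtain r where r: "I = ennreal r" "r \<ge> 0" by (metis ennreal_cases infinity_ennreal_def)
      have "r powr (1 / q) \<le> B \<longleftrightarrow> r \<le> B powr q"
      proof
        assume "r powr (1 / q) \<le> B"
        then have "(r powr (1 / q)) powr q \<le> B powr q" using q by (intro powr_mono2) auto
        then show "r \<le> B powr q" using q r by (simp add: powr_powr)
      next
        assume "r \<le> B powr q"
        then have "r powr (1 / q) \<le> (B powr q) powr (1 / q)" using q r by (intro powr_mono2) auto
        then show "r powr (1 / q) \<le> B" using q assms(4) by (simp add: powr_powr)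
      qed
      then show ?thesis using False fin r assms(4) unfolding Lp_le_def
        by (simp only: L q_def[symmetric] I_def[symmetric]) simp
    qed
  qed
qed

lemma Lp_le_mono:
  assumes "Lp_le p W g B" "V \<subseteq> W" "\<And>x. x \<in> V \<Longrightarrow> norm (h x) \<le> norm (g x)" "B \<le> C" "0 \<le> B"
  shows "Lp_le p V h C"
proof (cases "p = \<infinity>")
  case False
  define q where "q = enn2real p"
  have q: "q \<ge> 0" by (simp add: q_def)
  have "(\<integral>\<^sup>+x\<in>V. ennreal (norm (h x) powr q) \<partial>lborel) \<le>
      (\<integral>\<^sup>+x\<in>W. ennreal (norm (g x) powr q) \<partial>lborel)"
    using assms(2,3) q
    by (intro nn_integral_mono) (auto simp: indicator_def intro!: ennreal_leI powr_mono2)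
  also have "\<dots> \<le> ennreal (B powr q)" using assms(1) False by (simp add: Lp_le_def q_def)
  also have "\<dots> \<le> ennreal (C powr q)" using assms q by (intro ennreal_leI powr_mono2) auto
  finally show ?thesis using False by (simp add: Lp_le_def q_def)
qed (use assms in \<open>force simp: Lp_le_def\<close>)

lemma Lp_le_translation:
  fixes g :: "'a::euclidean_space \<Rightarrow> 'b::real_normed_vector"
  assumes "open V" "continuous_on V g" "1 \<le> p" "Lp_le p V g B" "0 \<le> B"
    and "\<And>x. x \<in> W \<Longrightarrow> x + z \<in> V"
  shows "Lp_le p W (\<lambda>x. g (x + z)) B"
proof (cases "p = \<infinity>")
  case False
  define q where "q = enn2real p"
  have q: "q \<ge> 1" unfolding q_def by (rule enn2real_ge_1[OF assms(3) False])
  have meas[measurable]: "(\<lambda>x. ennreal (norm (g x) powr q) * indicator V x) \<in> borel_measurable borel"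
    by (rule measurable_norm_powr_indicator) (use q assms in auto)
  have "(\<integral>\<^sup>+x\<in>W. ennreal (norm (g (x + z)) powr q) \<partial>lborel) \<le>
      (\<integral>\<^sup>+x. ennreal (norm (g (z + x)) powr q) * indicator V (z + x) \<partial>lborel)"
    using assms(6) by (intro nn_integral_mono) (auto simp: indicator_def add.commute)
  also have "\<dots> = (\<integral>\<^sup>+x. ennreal (norm (g x) powr q) * indicator V x \<partial>distr lborel borel ((+) z))"
    by (subst nn_integral_distr) auto
  also have "\<dots> = (\<integral>\<^sup>+x. ennreal (norm (g x) powr q) * indicator V x \<partial>lborel)"
    by (simp add: lborel_distr_plus)
  also have "\<dots> \<le> ennreal (B powr q)" using assms(4) False by (simp add: Lp_le_def q_def)
  finally show ?thesis using False by (simp add: Lp_le_def q_def)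
qed (use assms in \<open>auto simp: Lp_le_def\<close>)

text \<open>
  The weighted inequality of Young for \<open>r\<^sup>q\<close> and \<open>1\<close>, where
  \<open>r = t / s\<close>, gives \<open>r \<le> r\<^sup>q / q + 1 - 1 / q\<close>; this is
  the claim after scaling. Integrating the tangent line at the mean value yields Jensen's
  inequality below.
\<close>
lemma powr_above_tangent:
  fixes s t q :: real
  assumes "1 \<le> q" "0 < s" "0 \<le> t"
  shows "s powr q + q * s powr (q - 1) * (t - s) \<le> t powr q"
proof -
  define r where "r = t / s"
  have r: "r \<ge> 0" "t = s * r" using assms by (auto simp: r_def)
  have "r \<le> (1 / q) * (r powr q) + (1 - 1 / q)"
  proof (cases "r = 0")
    case False
    have "(r powr q) powr (1 / q) * 1 powr (1 - 1 / q) \<le> (1 / q) * (r powr q) + (1 - 1 / q) * 1"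
      using assms False r(1) by (intro Youngs_inequality_0) auto
    then show ?thesis using assms r by (simp add: powr_powr)
  qed (use assms in auto)
  then have "q * r \<le> q * ((1 / q) * (r powr q) + (1 - 1 / q))"
    using assms by (intro mult_left_mono) auto
  also have "\<dots> = r powr q + q - 1"
    using assms by (simp add: distrib_left right_diff_distrib)
  finally have "1 + q * (r - 1) \<le> r powr q"
    by (simp add: algebra_simps)
  then have "s powr q * (1 + q * (r - 1)) \<le> s powr q * r powr q"
    by (intro mult_left_mono) auto
  moreover have "s powr q = s * s powr (q - 1)"
    using assms(2) by (simp add: powr_diff)
  moreover have "t powr q = s powr q * r powr q"
    using assms(2) r by (simp add: powr_mult)
  ultimately show ?thesis using r(2) by (simp add: algebra_simps)
qed

lemma powr_convex_combination:
  fixes x y a b q :: real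
  assumes "1 \<le> q" "0 \<le> x" "0 \<le> y" "0 \<le> a" "0 \<le> b" "a + b = 1"
  shows "(a * x + b * y) powr q \<le> a * x powr q + b * y powr q"
proof (cases "a * x + b * y = 0")
  case True then show ?thesis using assms by simp
next
  case False
  define z where "z = a * x + b * y"
  have "z > 0" unfolding z_def using False assms by (metis add_nonneg_nonneg less_eq_real_def mult_nonneg_nonneg)
  have "a * (z powr q + q * z powr (q - 1) * (x - z)) + b * (z powr q + q * z powr (q - 1) * (y - z))
      \<le> a * x powr q + b * y powr q"
    using assms \<open>z > 0\<close> by (intro add_mono mult_left_mono powr_above_tangent) auto
  also have "a * (z powr q + q * z powr (q - 1) * (x - z)) + b * (z powr q + q * z powr (q - 1) * (y - z))
      = (a + b) * z powr q + q * z powr (q - 1) * (a * x + b * y - (a + b) * z)"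
    by (simp add: algebra_simps)
  also have "\<dots> = z powr q" using assms(6) by (simp add: z_def)
  finally show ?thesis by (simp add: z_def)
qed

text \<open>
  Minkowski's inequality: write \<open>\<bar>f\<bar> + \<bar>g\<bar>\<close> as \<open>A +
  B\<close> times the convex combination of \<open>\<bar>f\<bar> / A\<close> and
  \<open>\<bar>g\<bar> / B\<close> with weights proportional to \<open>A\<close> and
  \<open>B\<close>, and use the convexity of \<open>x\<^sup>p\<close>.
\<close>
lemma Lp_le_add:
  fixes f g :: "'a::euclidean_space \<Rightarrow> 'b::real_normed_vector"
  assumes "open W" "continuous_on W f" "continuous_on W g" "1 \<le> p"
    and "Lp_le p W f A" "Lp_le p W g B" "0 < A" "0 < B"
  shows "Lp_le p W (\<lambda>x. f x + g x) (A + B)"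
proof (cases "p = \<infinity>")
  case True
  then show ?thesis using assms(5,6) by (force simp: Lp_le_def intro: norm_triangle_mono)
next
  case False
  define q where "q = enn2real p"
  have q: "q \<ge> 1" unfolding q_def by (rule enn2real_ge_1[OF assms(4) False])
  define a b where "a = A / (A + B)" and "b = B / (A + B)"
  have ab: "a > 0" "b > 0" "a + b = 1" using assms(7,8) by (auto simp: a_def b_def add_divide_distrib[symmetric])
  define S where "S = (A + B) powr q"
  define ca cb where "ca = S * a * (1 / A powr q)" and "cb = S * b * (1 / B powr q)"
  have c0: "ca \<ge> 0" "cb \<ge> 0" using ab by (auto simp: ca_def cb_def S_def)
  have pt: "norm (f x + g x) powr q \<le> ca * norm (f x) powr q + cb * norm (g x) powr q" for x
  proof -
    have "norm (f x + g x) powr q \<le> (norm (f x) + norm (g x)) powr q"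
      using q by (intro powr_mono2 norm_triangle_ineq) auto
    also have "norm (f x) + norm (g x) = ((A + B) * a) * (norm (f x) / A) + ((A + B) * b) * (norm (g x) / B)"
    proof -
      have "(A + B) * a = A" "(A + B) * b = B" using assms(7,8) by (auto simp: a_def b_def)
      then show ?thesis using assms(7,8) by simp
    qed
    also have "\<dots> = (A + B) * (a * (norm (f x) / A) + b * (norm (g x) / B))"
      by (simp only: distrib_left mult.assoc)
    also have "\<dots> powr q = S * (a * (norm (f x) / A) + b * (norm (g x) / B)) powr q"
      unfolding S_def by (rule powr_mult)
    also have "\<dots> \<le> S * (a * (norm (f x) / A) powr q + b * (norm (g x) / B) powr q)"
      using q ab assms(7,8) by (intro mult_left_mono powr_convex_combination) (auto simp: S_def)
    also have "\<dots> = ca * norm (f x) powr q + cb * norm (g x) powr q"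
      using assms(7,8) by (simp add: powr_divide ca_def cb_def algebra_simps)
    finally show ?thesis .
  qed
  have m: "(\<lambda>x. ennreal (norm (f x) powr q) * indicator W x) \<in> borel_measurable borel"
       "(\<lambda>x. ennreal (norm (g x) powr q) * indicator W x) \<in> borel_measurable borel"
    using assms q by (auto intro!: measurable_norm_powr_indicator)
  have "(\<integral>\<^sup>+x\<in>W. ennreal (norm (f x + g x) powr q) \<partial>lborel) \<le>
     (\<integral>\<^sup>+x. ennreal ca * (ennreal (norm (f x) powr q) * indicator W x)
           + ennreal cb * (ennreal (norm (g x) powr q) * indicator W x) \<partial>lborel)"
    using pt c0 by (intro nn_integral_mono)
      (auto simp: indicator_def ennreal_mult'[symmetric] ennreal_plus[symmetric] simp del: ennreal_plus intro!: ennreal_leI)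
  also have "\<dots> = ennreal ca * (\<integral>\<^sup>+x\<in>W. ennreal (norm (f x) powr q) \<partial>lborel)
      + ennreal cb * (\<integral>\<^sup>+x\<in>W. ennreal (norm (g x) powr q) \<partial>lborel)"
    using m by (subst nn_integral_add) (auto simp: nn_integral_cmult)
  also have "\<dots> \<le> ennreal ca * ennreal (A powr q) + ennreal cb * ennreal (B powr q)"
    using assms(5,6) False by (intro add_mono mult_left_mono) (auto simp: Lp_le_def q_def)
  also have "\<dots> = ennreal (ca * A powr q + cb * B powr q)"
    using c0 by (simp add: ennreal_mult' ennreal_plus)
  also have "ca * A powr q + cb * B powr q = (a + b) * S"
    using assms(7,8) by (simp add: ca_def cb_def algebra_simps)
  finally show ?thesis using False ab by (simp add: Lp_le_def q_def S_def)
qed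

lemma Lp_le_scaleR:
  fixes g :: "'a::euclidean_space \<Rightarrow> 'b::real_normed_vector"
  assumes "open W" "continuous_on W g" "1 \<le> p" "Lp_le p W g B" "0 \<le> B"
  shows "Lp_le p W (\<lambda>x. c *\<^sub>R g x) (\<bar>c\<bar> * B)"
proof (cases "p = \<infinity>")
  case True
  then show ?thesis using assms(4) by (auto simp: Lp_le_def intro: mult_left_mono)
next
  case False
  define q where "q = enn2real p"
  have q: "q \<ge> 1" unfolding q_def by (rule enn2real_ge_1[OF assms(3) False])
  have "(\<integral>\<^sup>+x\<in>W. ennreal (norm (c *\<^sub>R g x) powr q) \<partial>lborel)
      = (\<integral>\<^sup>+x. ennreal (\<bar>c\<bar> powr q) * (ennreal (norm (g x) powr q) * indicator W x) \<partial>lborel)"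
    by (intro nn_integral_cong) (simp add: powr_mult ennreal_mult' mult.assoc)
  also have "\<dots> = ennreal (\<bar>c\<bar> powr q) * (\<integral>\<^sup>+x\<in>W. ennreal (norm (g x) powr q) \<partial>lborel)"
    using assms q by (intro nn_integral_cmult) (auto intro!: measurable_norm_powr_indicator)
  also have "\<dots> \<le> ennreal (\<bar>c\<bar> powr q) * ennreal (B powr q)"
    using assms(4) False by (intro mult_left_mono) (auto simp: Lp_le_def q_def)
  also have "\<dots> = ennreal ((\<bar>c\<bar> * B) powr q)"
    using assms(5) by (simp add: powr_mult ennreal_mult')
  finally show ?thesis using False by (simp add: Lp_le_def q_def)
qed

lemma Lp_le_diff:
  fixes f g :: "'a::euclidean_space \<Rightarrow> 'b::real_normed_vector"
  assumes "open W" "continuous_on W f" "continuous_on W g" "1 \<le> p"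
    and "Lp_le p W f A" "Lp_le p W g B" "0 < A" "0 < B"
  shows "Lp_le p W (\<lambda>x. f x - g x) (A + B)"
  using Lp_le_add[OF assms(1,2) _ assms(4,5) Lp_le_scaleR[OF assms(1,3,4,6), of "-1"]] assms
  by (simp add: continuous_on_minus)

lemma Lp_le_sum:
  fixes g :: "'i \<Rightarrow> 'a::euclidean_space \<Rightarrow> 'b::real_normed_vector"
  assumes "finite J" "J \<noteq> {}" "open W" "1 \<le> p"
    and "\<And>j. j \<in> J \<Longrightarrow> continuous_on W (g j)"
    and "\<And>j. j \<in> J \<Longrightarrow> Lp_le p W (g j) (B j)" and "\<And>j. j \<in> J \<Longrightarrow> 0 < B j"
  shows "Lp_le p W (\<lambda>x. \<Sum>j\<in>J. g j x) (\<Sum>j\<in>J. B j)"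
  using assms(1,2,5-7)
proof (induction rule: finite_ne_induct)
  case (insert j J)
  have "Lp_le p W (\<lambda>x. g j x + (\<Sum>j\<in>J. g j x)) (B j + (\<Sum>j\<in>J. B j))"
  proof (rule Lp_le_add[OF assms(3) _ _ assms(4)])
    show "continuous_on W (\<lambda>x. \<Sum>j\<in>J. g j x)" using insert by (intro continuous_intros) auto
    show "0 < (\<Sum>j\<in>J. B j)" using insert by (intro sum_pos) auto
  qed (use insert in auto)
  then show ?case using insert by simp
qed simp

text \<open>
  Jensen's inequality on the unit interval, by integrating the tangent line of
  \<open>x\<^sup>q\<close> at \<open>s\<close>.
\<close>
lemma norm_integral_powr_le:
  fixes g :: "real \<Rightarrow> 'b::banach"
  assumes "continuous_on {0..1} g" "1 \<le> q"
  shows "ennreal (norm (integral {0..1} g) powr q) \<le> (\<integral>\<^sup>+h\<in>{0..1}. ennreal (norm (g h) powr q) \<partial>lborel)"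
proof -
  define s where "s = norm (integral {0..1} g)"
  have cn: "continuous_on {0..1} (\<lambda>h. norm (g h))" using assms by (intro continuous_intros)
  have cq: "continuous_on {0..1} (\<lambda>h. norm (g h) powr q)"
    using assms by (intro continuous_on_powr' continuous_intros) auto
  note int = integrable_continuous_real[OF cn] integrable_continuous_real[OF cq]
  have "s powr q \<le> integral {0..1} (\<lambda>h. norm (g h) powr q)"
  proof (cases "s = 0")
    case True
    then show ?thesis using int assms(2) by (auto intro: integral_nonneg)
  next
    case False
    then have "s > 0" by (simp add: s_def)
    have "((\<lambda>h. s powr q + q * s powr (q - 1) * (norm (g h) - s)) has_integral
        s powr q + q * s powr (q - 1) * (integral {0..1} (\<lambda>h. norm (g h)) - s)) {0..1}"
    proof -
      have c: "((\<lambda>h::real. c) has_integral c) {0..1}" for c :: real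
        using has_integral_const_real[of c 0 1] by simp
      show ?thesis
        by (intro has_integral_add has_integral_mult_right has_integral_diff c integrable_integral int)
    qed
    then have "s powr q + q * s powr (q - 1) * (integral {0..1} (\<lambda>h. norm (g h)) - s)
        \<le> integral {0..1} (\<lambda>h. norm (g h) powr q)"
      by (rule has_integral_le[OF _ integrable_integral[OF int(2)]])
         (intro powr_above_tangent assms \<open>s > 0\<close> norm_ge_zero)
    moreover have "s \<le> integral {0..1} (\<lambda>h. norm (g h))"
      unfolding s_def
      by (intro integral_norm_bound_integral integrable_continuous_real assms int) auto
    ultimately show ?thesis using assms(2) \<open>s > 0\<close>
      by (smt (verit) mult_nonneg_nonneg powr_ge_zero)
  qed
  then have "ennreal (s powr q) \<le> ennreal (integral {0..1} (\<lambda>h. norm (g h) powr q))"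
    by (rule ennreal_leI)
  also have "\<dots> = (\<integral>\<^sup>+h\<in>{0..1}. ennreal (norm (g h) powr q) \<partial>lborel)"
    by (rule nn_integral_has_integral_lebesgue'[symmetric]) (auto intro: integrable_integral int)
  finally show ?thesis by (simp add: s_def)
qed

text \<open>
  Minkowski's integral inequality for averages: Jensen's inequality for each \<open>x\<close>,
  then an exchange of the order of integration.
\<close>
lemma Lp_le_integral:
  fixes G :: "'a::euclidean_space \<Rightarrow> real \<Rightarrow> 'b::banach"
  assumes "open W" "continuous_on (W \<times> {0..1}) (\<lambda>(x, h). G x h)" "1 \<le> p"
    and le: "\<And>h. h \<in> {0..1} \<Longrightarrow> Lp_le p W (\<lambda>x. G x h) B" and "0 \<le> B"
  shows "Lp_le p W (\<lambda>x. integral {0..1} (G x)) B"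
proof -
  have cont: "continuous_on {0..1} (G x)" if "x \<in> W" for x
  proof -
    have "continuous_on {0..1} (\<lambda>h::real. (x, h))" by (intro continuous_intros)
    from continuous_on_compose2[OF assms(2) this] that show ?thesis by auto
  qed
  show ?thesis
  proof (cases "p = \<infinity>")
    case True
    have "norm (integral {0..1} (G x)) \<le> B" if "x \<in> W" for x
      using integral_bound[of 0 1 "G x" B] cont[OF that] le that True by (auto simp: Lp_le_def)
    then show ?thesis by (simp add: Lp_le_def True)
  next
    case False
    define q where "q = enn2real p"
    have q: "q \<ge> 1" unfolding q_def by (rule enn2real_ge_1[OF assms(3) False])
    define f where "f = (\<lambda>(x, h). ennreal (norm (G x h) powr q) * indicator (W \<times> {0..1}) (x, h))"
    have fm: "f \<in> borel_measurable (lborel \<Otimes>\<^sub>M lborel)"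
    proof -
      have "W \<times> {0..1::real} \<in> sets borel"
        unfolding borel_prod[symmetric] using assms(1) by auto
      then show ?thesis
        using measurable_norm_powr_indicator[OF _ assms(2), of q] q
        by (simp add: f_def lborel_prod case_prod_unfold)
    qed
    have "(\<integral>\<^sup>+x\<in>W. ennreal (norm (integral {0..1} (G x)) powr q) \<partial>lborel)
        \<le> (\<integral>\<^sup>+x. (\<integral>\<^sup>+h. f (x, h) \<partial>lborel) \<partial>lborel)"
    proof (intro nn_integral_mono)
      fix x
      show "ennreal (norm (integral {0..1} (G x)) powr q) * indicator W x \<le> (\<integral>\<^sup>+h. f (x, h) \<partial>lborel)"
        using norm_integral_powr_le[OF cont q, of x]
        by (cases "x \<in> W") (auto simp: f_def indicator_times)
    qed
    also have "\<dots> = (\<integral>\<^sup>+h. (\<integral>\<^sup>+x. f (x, h) \<partial>lborel) \<partial>lborel)"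
      by (rule lborel_pair.Fubini[OF fm, symmetric])
    also have "\<dots> \<le> (\<integral>\<^sup>+h\<in>{0..1::real}. ennreal (B powr q) \<partial>lborel)"
    proof (intro nn_integral_mono)
      fix h :: real
      show "(\<integral>\<^sup>+x. f (x, h) \<partial>lborel) \<le> ennreal (B powr q) * indicator {0..1} h"
        using le[of h] False
        by (cases "h \<in> {0..1}") (auto simp: f_def indicator_times Lp_le_def q_def)
    qed
    also have "\<dots> = ennreal (B powr q)" by (simp add: nn_integral_cmult_indicator)
    finally show ?thesis using False by (simp add: Lp_le_def q_def)
  qed
qed

section \<open>Iterated differences along lines\<close>

text \<open>
  The iterated forward difference \<open>\<Delta>\<^sub>h\<^sub>1 \<dots>
  \<Delta>\<^sub>h\<^sub>r u\<close> with a list of possibly different steps. Functions on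
  \<open>\<real>\<^sup>n\<close> are differenced along a line, that is, applied to \<open>u t
  = F (x + t v)\<close>.
\<close>
primrec idiff :: "real list \<Rightarrow> (real \<Rightarrow> 'b::real_normed_vector) \<Rightarrow> real \<Rightarrow> 'b" where
  "idiff [] u = u"
| "idiff (h # hs) u = (\<lambda>t. idiff hs u (t + h) - idiff hs u t)"

lemma idiff_append: "idiff (xs @ ys) u = idiff xs (idiff ys u)"
  by (induction xs) auto

lemma idiff_replicate:
  "idiff (replicate m h) u t = (\<Sum>i\<le>m. ((-1) ^ (m + i) * real (m choose i)) *\<^sub>R u (t + real i * h))"
proof (induction m arbitrary: t)
  case (Suc m)
  define c where "c m i = (-1) ^ (m + i) * real (m choose i)" for m i
  let ?u = "\<lambda>i. u (t + real i * h)"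
  have cS: "c (Suc m) (Suc i) = c m i - c m (Suc i)" for i
    by (simp add: c_def algebra_simps)
  have "(\<Sum>i\<le>Suc m. c (Suc m) i *\<^sub>R ?u i)
      = c (Suc m) 0 *\<^sub>R ?u 0 + (\<Sum>i\<le>m. c m i *\<^sub>R ?u (Suc i)) - (\<Sum>i\<le>m. c m (Suc i) *\<^sub>R ?u (Suc i))"
    by (subst sum.atMost_Suc_shift) (simp add: cS scaleR_left_diff_distrib sum_subtractf)
  also have "(\<Sum>i\<le>m. c m (Suc i) *\<^sub>R ?u (Suc i)) = (\<Sum>i\<le>Suc m. c m i *\<^sub>R ?u i) - c m 0 *\<^sub>R ?u 0"
    by (subst sum.atMost_Suc_shift) simp
  also have "(\<Sum>i\<le>Suc m. c m i *\<^sub>R ?u i) = (\<Sum>i\<le>m. c m i *\<^sub>R ?u i)"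
    by (simp add: c_def)
  also have "c (Suc m) 0 = - c m 0" by (simp add: c_def)
  finally have "(\<Sum>i\<le>Suc m. c (Suc m) i *\<^sub>R ?u i)
      = (\<Sum>i\<le>m. c m i *\<^sub>R ?u (Suc i)) - (\<Sum>i\<le>m. c m i *\<^sub>R ?u i)" by simp
  moreover have "?u (Suc i) = u (t + h + real i * h)" for i by (simp add: algebra_simps)
  ultimately show ?case using Suc.IH by (simp add: c_def)
qed simp

lemma idiff_has_vector_derivative:
  assumes "\<And>s. \<bar>s\<bar> \<le> T \<Longrightarrow> (u has_vector_derivative u' s) (at s)"
    and "\<bar>t\<bar> + sum_list (map abs hs) \<le> T"
  shows "(idiff hs u has_vector_derivative idiff hs u' t) (at t)"
  using assms(2)
proof (induction hs arbitrary: t)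
  case (Cons h hs)
  have "((\<lambda>t. t + h) has_vector_derivative 1) (at t)"
    by (auto intro!: derivative_eq_intros)
  moreover have "(idiff hs u has_vector_derivative idiff hs u' (t + h)) (at (t + h))"
    using Cons.prems by (intro Cons.IH) auto
  ultimately have "((idiff hs u \<circ> (\<lambda>t. t + h)) has_vector_derivative 1 *\<^sub>R idiff hs u' (t + h)) (at t)"
    by (intro vector_diff_chain_at)
  then have "((\<lambda>t. idiff hs u (t + h)) has_vector_derivative idiff hs u' (t + h)) (at t)"
    by (simp add: o_def)
  moreover have "(idiff hs u has_vector_derivative idiff hs u' t) (at t)"
    using Cons.prems by (intro Cons.IH) auto
  ultimately show ?case by (auto intro: derivative_intros)
qed (use assms in auto)

lemma increment_eq_integral:
  fixes f :: "real \<Rightarrow> 'b::banach"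
  assumes "\<And>\<tau>. \<tau> \<in> {0..1} \<Longrightarrow> (f has_vector_derivative f' (a + \<tau> * h)) (at (a + \<tau> * h))"
  shows "f (a + h) - f a = integral {0..1} (\<lambda>\<tau>. h *\<^sub>R f' (a + \<tau> * h))"
proof -
  have "((\<lambda>\<tau>. f (a + \<tau> * h)) has_vector_derivative h *\<^sub>R f' (a + \<tau> * h)) (at \<tau> within {0..1})"
    if "\<tau> \<in> {0..1}" for \<tau>
  proof -
    have "((\<lambda>\<tau>. a + \<tau> * h) has_vector_derivative h) (at \<tau>)"
      by (auto intro!: derivative_eq_intros)
    from vector_diff_chain_at[OF this assms[OF that]]
    show ?thesis by (simp add: o_def has_vector_derivative_at_within)
  qed
  from fundamental_theorem_of_calculus[OF _ this]
  have "((\<lambda>\<tau>. h *\<^sub>R f' (a + \<tau> * h)) has_integral f (a + h) - f a) {0..1}" by simp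
  then show ?thesis by (rule integral_unique[symmetric])
qed

text \<open>
  The steps and the base point may depend on the parameter \<open>z\<close>: the differences
  have to be continuous jointly in the point and in the step size before the step size is
  integrated out.
\<close>
lemma continuous_on_idiff:
  fixes H :: "'a::real_normed_vector \<Rightarrow> 'b::real_normed_vector"
  assumes "continuous_on U H" "continuous_on Z X" "continuous_on Z a"
    and "\<And>f. f \<in> set hs \<Longrightarrow> continuous_on Z f"
    and "\<And>z t. z \<in> Z \<Longrightarrow> \<bar>t\<bar> \<le> \<bar>a z\<bar> + (\<Sum>f\<leftarrow>hs. \<bar>f z\<bar>) \<Longrightarrow> X z + t *\<^sub>R v \<in> U"
  shows "continuous_on Z (\<lambda>z. idiff (map (\<lambda>f. f z) hs) (\<lambda>t. H (X z + t *\<^sub>R v)) (a z))"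
  using assms(3-5)
proof (induction hs arbitrary: a)
  case Nil
  then show ?case
    by (auto intro!: continuous_on_compose2[OF assms(1)] continuous_intros assms(2))
next
  case (Cons f hs)
  have "continuous_on Z (\<lambda>z. idiff (map (\<lambda>f. f z) hs) (\<lambda>t. H (X z + t *\<^sub>R v)) (a z + f z))"
    using Cons.prems by (intro Cons.IH continuous_intros) auto
  moreover have "continuous_on Z (\<lambda>z. idiff (map (\<lambda>f. f z) hs) (\<lambda>t. H (X z + t *\<^sub>R v)) (a z))"
    using Cons.prems by (intro Cons.IH) auto
  ultimately show ?case by (auto intro: continuous_intros)
qed

lemma continuous_on_idiff_line:
  fixes H :: "'a::real_normed_vector \<Rightarrow> 'b::real_normed_vector"
  assumes "continuous_on U H"
    and "\<And>x t. x \<in> W \<Longrightarrow> \<bar>t\<bar> \<le> \<bar>a\<bar> + sum_list (map abs hs) \<Longrightarrow> x + t *\<^sub>R v \<in> U"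
  shows "continuous_on W (\<lambda>x. idiff hs (\<lambda>t. H (x + t *\<^sub>R v)) a)"
  using continuous_on_idiff[OF assms(1), of W "\<lambda>x. x" "\<lambda>_. a" "map (\<lambda>h _. h) hs" v] assms(2)
  by (auto simp: o_def intro: continuous_intros)

text \<open>
  Each difference operator with step \<open>h\<close> is \<open>h\<close> times an average of
  translates of \<open>\<partial>\<^sub>v\<close>, and neither averages nor translations
  increase the norm. So a difference of order \<open>r\<close> with steps at most
  \<open>1\<close> is controlled by \<open>\<partial>\<^sub>v\<^sup>r F\<close>, on a domain
  large enough for all the translates.
\<close>
lemma Lp_le_idiff:
  fixes F :: "'a::euclidean_space \<Rightarrow> 'b::banach"
  assumes "open V" "open W" "1 \<le> p" "0 \<le> B"
    and "\<And>x t. x \<in> W \<Longrightarrow> \<bar>t\<bar> \<le> T \<Longrightarrow> x + t *\<^sub>R v \<in> V"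
    and "smooth_on V F" "Lp_le p V ((dir_deriv v ^^ length hs) F) B"
    and "\<And>h. h \<in> set hs \<Longrightarrow> \<bar>h\<bar> \<le> 1" "\<bar>a\<bar> + sum_list (map abs hs) \<le> T"
  shows "Lp_le p W (\<lambda>x. idiff hs (\<lambda>t. F (x + t *\<^sub>R v)) a) B"
  using assms(6-)
proof (induction hs arbitrary: F a)
  case Nil
  then show ?case
    using assms(1-5) by (auto intro!: Lp_le_translation[of V] smooth_on_imp_continuous_on)
next
  case (Cons h hs)
  define F' where "F' = dir_deriv v F"
  have F': "smooth_on V F'" unfolding F'_def by (intro smooth_on_dir_deriv Cons.prems)
  have h: "\<bar>h\<bar> \<le> 1" using Cons.prems by auto
  have range: "\<bar>a + \<tau> * h\<bar> + sum_list (map abs hs) \<le> T" if "\<tau> \<in> {0..1}" for \<tau>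
  proof -
    have "\<bar>\<tau> * h\<bar> \<le> 1 * \<bar>h\<bar>" using that unfolding abs_mult by (intro mult_right_mono) auto
    then have "\<bar>a + \<tau> * h\<bar> \<le> \<bar>a\<bar> + \<bar>h\<bar>" by linarith
    then show ?thesis using Cons.prems(4) by simp
  qed
  have hvd: "((\<lambda>t. F (x + t *\<^sub>R v)) has_vector_derivative F' (x + s *\<^sub>R v)) (at s)"
    if "x \<in> W" "\<bar>s\<bar> \<le> T" for x s
    unfolding F'_def using that assms(5) Cons.prems by (intro has_vector_derivative_along_line)
  have eq: "idiff (h # hs) (\<lambda>t. F (x + t *\<^sub>R v)) a
      = integral {0..1} (\<lambda>\<tau>. h *\<^sub>R idiff hs (\<lambda>t. F' (x + t *\<^sub>R v)) (a + \<tau> * h))" if "x \<in> W" for x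
    using increment_eq_integral[where a = a and h = h, OF idiff_has_vector_derivative[OF hvd[OF that] range]]
    by simp
  have "Lp_le p W (\<lambda>x. integral {0..1} (\<lambda>\<tau>. h *\<^sub>R idiff hs (\<lambda>t. F' (x + t *\<^sub>R v)) (a + \<tau> * h))) B"
  proof (rule Lp_le_integral[OF assms(2) _ assms(3) _ assms(4)])
    have "continuous_on (W \<times> {0..1}) (\<lambda>z. idiff (map (\<lambda>f. f z) (map (\<lambda>h _. h) hs))
            (\<lambda>t. F' (fst z + t *\<^sub>R v)) (a + snd z * h))"
    proof (rule continuous_on_idiff[OF smooth_on_imp_continuous_on[OF F']])
      fix z :: "'a \<times> real" and t
      assume "z \<in> W \<times> {0..1}" "\<bar>t\<bar> \<le> \<bar>a + snd z * h\<bar> + (\<Sum>f\<leftarrow>map (\<lambda>h _. h) hs. \<bar>f z\<bar>)"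
      then show "fst z + t *\<^sub>R v \<in> V"
        using range[of "snd z"] by (intro assms(5)) (auto simp: o_def)
    qed (auto intro!: continuous_intros)
    then show "continuous_on (W \<times> {0..1}) (\<lambda>(x, \<tau>). h *\<^sub>R idiff hs (\<lambda>t. F' (x + t *\<^sub>R v)) (a + \<tau> * h))"
      by (auto simp: o_def case_prod_unfold intro!: continuous_intros)
    fix \<tau> :: real assume \<tau>: "\<tau> \<in> {0..1}"
    have "Lp_le p W (\<lambda>x. idiff hs (\<lambda>t. F' (x + t *\<^sub>R v)) (a + \<tau> * h)) B"
      using Cons.prems range[OF \<tau>] F' by (intro Cons.IH) (auto simp: F'_def funpow_swap1)
    then show "Lp_le p W (\<lambda>x. h *\<^sub>R idiff hs (\<lambda>t. F' (x + t *\<^sub>R v)) (a + \<tau> * h)) B"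
      by (rule Lp_le_mono) (use h assms(4) in \<open>auto intro: mult_left_le_one_le\<close>)
  qed
  then show ?case by (rule Lp_le_mono) (use eq assms(4) in auto)
qed

text \<open>
  The other way to estimate a difference: every step costs a factor \<open>2\<close> but no
  derivative.
\<close>
lemma Lp_le_idiff_crude:
  fixes F :: "'a::euclidean_space \<Rightarrow> 'b::real_normed_vector"
  assumes "open V" "open W" "1 \<le> p" "0 < A" "continuous_on V F" "Lp_le p V F A"
    and "\<And>x t. x \<in> W \<Longrightarrow> \<bar>t\<bar> \<le> T \<Longrightarrow> x + t *\<^sub>R v \<in> V"
    and "\<bar>a\<bar> + sum_list (map abs hs) \<le> T"
  shows "Lp_le p W (\<lambda>x. idiff hs (\<lambda>t. F (x + t *\<^sub>R v)) a) (2 ^ length hs * A)"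
  using assms(8)
proof (induction hs arbitrary: a)
  case Nil
  then show ?case using assms by (auto intro!: Lp_le_translation[of V])
next
  case (Cons h hs)
  have r: "\<bar>a + h\<bar> + sum_list (map abs hs) \<le> T" "\<bar>a\<bar> + sum_list (map abs hs) \<le> T"
    using Cons.prems by auto
  have c: "continuous_on W (\<lambda>x. idiff hs (\<lambda>t. F (x + t *\<^sub>R v)) b)"
    if "\<bar>b\<bar> + sum_list (map abs hs) \<le> T" for b
    using that assms(7) by (intro continuous_on_idiff_line[OF assms(5)]) auto
  have "Lp_le p W (\<lambda>x. idiff hs (\<lambda>t. F (x + t *\<^sub>R v)) (a + h) - idiff hs (\<lambda>t. F (x + t *\<^sub>R v)) a)
     (2 ^ length hs * A + 2 ^ length hs * A)"
    using assms(4) by (intro Lp_le_diff assms(2,3) c r Cons.IH) auto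
  then show ?case by (simp add: algebra_simps)
qed

text \<open>
  The identity \<open>D = log (1 + \<Delta>)\<close>, truncated after the difference of order
  \<open>m\<close>, with an explicit remainder. Differentiating
  \<open>\<Delta>\<^sub>h\<^sup>m\<^sup>+\<^sup>1 u 0\<close> with respect to \<open>h\<close>
  gives \<open>(m + 1) \<Delta>\<^sub>h\<^sup>m u' h = (m + 1) (\<Delta>\<^sub>h\<^sup>m u' 0
  + \<Delta>\<^sub>h\<^sup>m\<^sup>+\<^sup>1 u' 0)\<close>, and integrating this over
  \<open>[0, 1]\<close> relates the remainders for \<open>m\<close> and \<open>m + 1\<close>.
\<close>
lemma deriv_eq_log_series_differences:
  fixes u :: "real \<Rightarrow> 'b::banach"
  assumes hvd: "\<And>t. \<bar>t\<bar> \<le> real m \<Longrightarrow> (u has_vector_derivative u' t) (at t)"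
    and cont: "continuous_on {- real m..real m} u'"
  shows "u' 0 = (\<Sum>j=1..m. ((-1) ^ (j - 1) / real j) *\<^sub>R idiff (replicate j 1) u 0)
      + (-1) ^ m *\<^sub>R integral {0..1} (\<lambda>h. idiff (replicate m h) u' 0)"
  using assms
proof (induction m)
  case (Suc m)
  let ?I = "\<lambda>n. integral {0..1} (\<lambda>h. idiff (replicate n h) u' 0)"
  have c: "continuous_on {0..1} (\<lambda>h. idiff (replicate n h) u' 0)" if "n \<le> Suc m" for n
  proof -
    have "continuous_on {0..1} (\<lambda>h. u' (0 + real i * h))" if "i \<le> n" for i
    proof (rule continuous_on_compose2[OF Suc.prems(2)])
      show "(\<lambda>h. 0 + real i * h) ` {0..1} \<subseteq> {- real (Suc m)..real (Suc m)}"
      proof safe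
        fix h :: real assume "h \<in> {0..1}"
        moreover have "i \<le> Suc m" using that \<open>n \<le> Suc m\<close> by simp
        ultimately have "0 \<le> real i * h" "real i * h \<le> real (Suc m) * 1"
          by (intro mult_nonneg_nonneg mult_mono; simp)+
        then show "0 + real i * h \<in> {- real (Suc m)..real (Suc m)}" by simp
      qed
    qed (intro continuous_intros)
    then show ?thesis unfolding idiff_replicate by (intro continuous_intros) auto
  qed
  have "((\<lambda>h. idiff (replicate (Suc m) h) u 0) has_vector_derivative
      real (Suc m) *\<^sub>R (idiff (replicate m h) u' 0 + idiff (replicate (Suc m) h) u' 0)) (at h within {0..1})"
    if h: "h \<in> {0..1}" for h
  proof -
    define c where "c m i = (-1) ^ (m + i) * real (m choose i)" for m i
    have d: "((\<lambda>h. u (real i * h)) has_vector_derivative real i *\<^sub>R u' (real i * h)) (at h)"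
      if "i \<le> Suc m" for i
    proof -
      have 1: "((\<lambda>h. real i * h) has_vector_derivative real i) (at h)"
        by (auto intro!: derivative_eq_intros)
      have "\<bar>real i * h\<bar> \<le> real (Suc m) * 1"
        using that h unfolding abs_mult by (intro mult_mono) auto
      then show ?thesis
        using vector_diff_chain_at[OF 1 Suc.prems(1)[of "real i * h"]] by (simp add: o_def)
    qed
    have "((\<lambda>h. \<Sum>i\<le>Suc m. c (Suc m) i *\<^sub>R u (real i * h)) has_vector_derivative
       (\<Sum>i\<le>Suc m. c (Suc m) i *\<^sub>R (real i *\<^sub>R u' (real i * h)))) (at h)"
      by (intro has_vector_derivative_sum bounded_linear.has_vector_derivative[OF bounded_linear_scaleR_right] d) auto
    also have "(\<lambda>h. \<Sum>i\<le>Suc m. c (Suc m) i *\<^sub>R u (real i * h)) = (\<lambda>h. idiff (replicate (Suc m) h) u 0)"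
      by (simp only: idiff_replicate c_def add_0)
    also have "(\<Sum>i\<le>Suc m. c (Suc m) i *\<^sub>R (real i *\<^sub>R u' (real i * h)))
       = (\<Sum>i\<le>m. real (Suc m) *\<^sub>R (c m i *\<^sub>R u' (h + real i * h)))"
    proof (subst sum.atMost_Suc_shift, simp del: of_nat_Suc, intro sum.cong refl)
      fix i
      have "c (Suc m) (Suc i) * real (Suc i) = (-1) ^ (m + i) * real (Suc i * (Suc m choose Suc i))"
        unfolding c_def of_nat_mult by (simp add: mult.commute del: of_nat_Suc binomial_Suc_Suc)
      also have "\<dots> = real (Suc m) * c m i"
        unfolding Suc_times_binomial of_nat_mult c_def by (simp del: of_nat_Suc)
      finally show "(c (Suc m) (Suc i) * real (Suc i)) *\<^sub>R u' (real (Suc i) * h)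
          = (real (Suc m) * c m i) *\<^sub>R u' (h + real i * h)"
        by (simp add: algebra_simps)
    qed
    also have "\<dots> = real (Suc m) *\<^sub>R idiff (replicate m h) u' h"
      unfolding idiff_replicate scaleR_sum_right c_def ..
    also have "idiff (replicate m h) u' h = idiff (replicate m h) u' 0 + idiff (replicate (Suc m) h) u' 0"
      by simp
    finally show ?thesis by (rule has_vector_derivative_at_within)
  qed
  from fundamental_theorem_of_calculus[OF _ this]
  have "((\<lambda>h. real (Suc m) *\<^sub>R (idiff (replicate m h) u' 0 + idiff (replicate (Suc m) h) u' 0))
      has_integral idiff (replicate (Suc m) 1) u 0) {0..1}" by simp
  moreover have "((\<lambda>h. real (Suc m) *\<^sub>R (idiff (replicate m h) u' 0 + idiff (replicate (Suc m) h) u' 0))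
      has_integral real (Suc m) *\<^sub>R (?I m + ?I (Suc m))) {0..1}"
    by (intro has_integral_cmul has_integral_add integrable_integral integrable_continuous_real c) auto
  ultimately have "real (Suc m) *\<^sub>R (?I m + ?I (Suc m)) = idiff (replicate (Suc m) 1) u 0"
    by (rule has_integral_unique[rotated])
  have I: "?I m = (1 / real (Suc m)) *\<^sub>R idiff (replicate (Suc m) 1) u 0 - ?I (Suc m)"
  proof -
    have "?I m + ?I (Suc m) = (1 / real (Suc m)) *\<^sub>R (real (Suc m) *\<^sub>R (?I m + ?I (Suc m)))"
      by (simp del: of_nat_Suc replicate.simps)
    then show ?thesis
      unfolding \<open>real (Suc m) *\<^sub>R (?I m + ?I (Suc m)) = idiff (replicate (Suc m) 1) u 0\<close>
      by (simp only: eq_diff_eq)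
  qed
  have IH: "u' 0 = (\<Sum>j=1..m. ((-1) ^ (j - 1) / real j) *\<^sub>R idiff (replicate j 1) u 0) + (-1) ^ m *\<^sub>R ?I m"
    using Suc.prems by (intro Suc.IH) (auto elim: continuous_on_subset)
  have "(-1) ^ m *\<^sub>R ?I m = ((-1) ^ m / real (Suc m)) *\<^sub>R idiff (replicate (Suc m) 1) u 0
      + (-1) ^ Suc m *\<^sub>R ?I (Suc m)"
    unfolding I by (simp add: scaleR_right_diff_distrib del: replicate.simps idiff.simps of_nat_Suc)
  then show ?case
    unfolding IH by (simp add: sum.atLeast_Suc_atMost del: replicate.simps idiff.simps of_nat_Suc)
qed simp

section \<open>A local interpolation inequality\<close>

lemma idiff_deriv_eq_log_series:
  fixes u :: "real \<Rightarrow> 'b::banach"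
  assumes hvd: "\<And>t. \<bar>t\<bar> \<le> real (l + m) \<Longrightarrow> (u has_vector_derivative u' t) (at t)"
    and cont: "continuous_on {- real (l + m)..real (l + m)} u'"
  shows "idiff (replicate l 1) u' 0 =
      (\<Sum>j=1..m. ((-1) ^ (j - 1) / real j) *\<^sub>R idiff (replicate (j + l) 1) u 0)
      + (-1) ^ m *\<^sub>R integral {0..1} (\<lambda>h. idiff (replicate m h @ replicate l 1) u' 0)"
proof -
  have "continuous_on {- real m..real m} (idiff (replicate l 1) u')"
    unfolding idiff_replicate
    by (intro continuous_intros continuous_on_compose2[OF cont]) auto
  moreover have "(idiff (replicate l 1) u has_vector_derivative idiff (replicate l 1) u' t) (at t)"
    if "\<bar>t\<bar> \<le> real m" for t
    using that by (intro idiff_has_vector_derivative[OF hvd]) (auto simp: sum_list_replicate)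
  ultimately have "idiff (replicate l 1) u' 0 =
      (\<Sum>j=1..m. ((-1) ^ (j - 1) / real j) *\<^sub>R idiff (replicate j 1) (idiff (replicate l 1) u) 0)
      + (-1) ^ m *\<^sub>R integral {0..1} (\<lambda>h. idiff (replicate m h) (idiff (replicate l 1) u') 0)"
    by (intro deriv_eq_log_series_differences)
  then show ?thesis by (simp add: idiff_append replicate_add)
qed

text \<open>
  The identity of the previous lemma trades a derivative for differences,
  \<open>\<Delta>\<^sup>l \<partial>\<^sub>v\<^sup>i F\<close> being a combination of
  \<open>\<Delta>\<^sup>l\<^sup>+\<^sup>j \<partial>\<^sub>v\<^sup>i\<^sup>-\<^sup>1 F\<close>
  for \<open>1 \<le> j \<le> N - i - l\<close> and of a remainder in which \<open>F\<close> is
  differentiated or differenced \<open>N\<close> times in all. Keeping track of the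
  differences, instead of estimating them at once, keeps all translates within distance
  \<open>N\<close>, no matter how many derivatives are traded. The bound decays like
  \<open>2\<^sup>-\<^sup>l\<close>, so that the sum over \<open>j\<close> is a geometric
  series. For \<open>l = 0\<close> all derivatives of order at most \<open>N\<close> are
  bounded, with an exponential constant.
\<close>
lemma Lp_le_idiff_iterated_deriv:
  fixes F :: "'a::euclidean_space \<Rightarrow> 'b::banach"
  assumes V: "open V" and W: "open W" and p: "1 \<le> p" and A: "0 < A"
    and sm: "smooth_on V F"
    and rng: "\<And>x t. x \<in> W \<Longrightarrow> \<bar>t\<bar> \<le> real N \<Longrightarrow> x + t *\<^sub>R v \<in> V"
    and F0: "Lp_le p V F A" and FN: "Lp_le p V ((dir_deriv v ^^ N) F) A"
  shows "i + l \<le> N \<Longrightarrow>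
    Lp_le p W (\<lambda>x. idiff (replicate l 1) (\<lambda>t. (dir_deriv v ^^ i) F (x + t *\<^sub>R v)) 0)
      (2 ^ i / 2 ^ l * 4 ^ N * A)"
proof (induction i arbitrary: l)
  case 0
  have "Lp_le p W (\<lambda>x. idiff (replicate l 1) (\<lambda>t. F (x + t *\<^sub>R v)) 0) (2 ^ length (replicate l (1::real)) * A)"
    using 0 by (intro Lp_le_idiff_crude[OF V W p A smooth_on_imp_continuous_on[OF sm] F0 rng])
      (auto simp: sum_list_replicate)
  then have "Lp_le p W (\<lambda>x. idiff (replicate l 1) (\<lambda>t. (dir_deriv v ^^ 0) F (x + t *\<^sub>R v)) 0) (2 ^ l * A)"
    by simp
  then show ?case
  proof (rule Lp_le_mono)
    \<comment> \<open>The factor \<open>4\<^sup>N\<close> absorbs \<open>2\<^sup>l\<close> twice: once from the differences of \<open>F\<close> and once to allow the decay \<open>2\<^sup>-\<^sup>l\<close>.\<close>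
    have "(2::real) ^ l * 2 ^ l \<le> 4 ^ N"
      using 0 by (simp add: power_mult_distrib[symmetric] power_increasing)
    then have "2 ^ l \<le> 1 / 2 ^ l * (4::real) ^ N" by (simp add: field_simps)
    from mult_right_mono[OF this, of A] show "2 ^ l * A \<le> 2 ^ 0 / 2 ^ l * 4 ^ N * A"
      using A by simp
  qed (use A in auto)
next
  case (Suc i)
  define m where "m = N - Suc i - l"
  have N: "N = m + l + Suc i" using Suc.prems by (simp add: m_def)
  define G where "G = (dir_deriv v ^^ i) F"
  define G' where "G' = dir_deriv v G"
  have G: "smooth_on V G" and G': "smooth_on V G'"
    unfolding G_def G'_def by (intro smooth_on_dir_deriv smooth_on_iterated_dir_deriv sm)+
  let ?d = "\<lambda>l g x. idiff (replicate l 1) (\<lambda>t. g (x + t *\<^sub>R v)) 0"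
  let ?I = "\<lambda>x. integral {0..1} (\<lambda>h. idiff (replicate m h @ replicate l 1) (\<lambda>t. G' (x + t *\<^sub>R v)) 0)"
  define X where "X = 4 ^ N * A"
  have X: "X > 0" using A by (simp add: X_def)
  have eq: "?d l G' x = (\<Sum>j=1..m. ((-1) ^ (j - 1) / real j) *\<^sub>R ?d (j + l) G x) + (-1) ^ m *\<^sub>R ?I x"
    if x: "x \<in> W" for x
  proof (rule idiff_deriv_eq_log_series)
    show "((\<lambda>t. G (x + t *\<^sub>R v)) has_vector_derivative G' (x + t *\<^sub>R v)) (at t)"
      if "\<bar>t\<bar> \<le> real (l + m)" for t
      unfolding G'_def using that x by (intro has_vector_derivative_along_line[OF G] rng) (auto simp: N)
    show "continuous_on {- real (l + m)..real (l + m)} (\<lambda>t. G' (x + t *\<^sub>R v))"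
      using x by (intro continuous_on_compose2[OF smooth_on_imp_continuous_on[OF G']] continuous_intros)
        (auto intro!: rng simp: N)
  qed
  have LI: "Lp_le p W ?I A"
  proof (rule Lp_le_integral[OF W _ p])
    have "continuous_on (W \<times> {0..1}) (\<lambda>z. idiff (map (\<lambda>f. f z) (replicate m snd @ replicate l (\<lambda>_. 1)))
            (\<lambda>t. G' (fst z + t *\<^sub>R v)) 0)"
    proof (rule continuous_on_idiff[OF smooth_on_imp_continuous_on[OF G']])
      fix z :: "'a \<times> real" and t
      assume z: "z \<in> W \<times> {0..1}"
        and t: "\<bar>t\<bar> \<le> \<bar>0\<bar> + (\<Sum>f\<leftarrow>replicate m snd @ replicate l (\<lambda>_. 1). \<bar>f z\<bar>)"
      have "real m * snd z \<le> real m * 1" using z by (intro mult_left_mono) auto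
      then have "\<bar>t\<bar> \<le> real N" using t z by (auto simp: sum_list_replicate N)
      then show "fst z + t *\<^sub>R v \<in> V" using z by (auto intro!: rng)
    qed (auto intro!: continuous_intros)
    then show "continuous_on (W \<times> {0..1})
        (\<lambda>(x, h). idiff (replicate m h @ replicate l 1) (\<lambda>t. G' (x + t *\<^sub>R v)) 0)"
      by (simp add: case_prod_unfold)
    fix h :: real assume h: "h \<in> {0..1}"
    have "real m * h \<le> real m * 1" using h by (intro mult_left_mono) auto
    moreover have "Lp_le p V ((dir_deriv v ^^ length (replicate m h @ replicate l 1)) G') A"
    proof -
      have "(dir_deriv v ^^ (m + l)) G' = (dir_deriv v ^^ N) F"
        by (simp add: N G_def G'_def funpow_add funpow_swap1)
      then show ?thesis using FN by simp
    qed
    ultimately show "Lp_le p W (\<lambda>x. idiff (replicate m h @ replicate l 1) (\<lambda>t. G' (x + t *\<^sub>R v)) 0) A"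
      using h A by (intro Lp_le_idiff[OF V W p _ rng G']) (auto simp: sum_list_replicate N)
  qed (use A in auto)
  have cd: "continuous_on W (?d (j + l) G)" if "j \<le> m" for j
    using that by (intro continuous_on_idiff_line[OF smooth_on_imp_continuous_on[OF G]] rng)
      (auto simp: sum_list_replicate N)
  have cG': "continuous_on W (?d l G')"
    by (intro continuous_on_idiff_line[OF smooth_on_imp_continuous_on[OF G']] rng)
      (auto simp: sum_list_replicate N)
  have "continuous_on W (\<lambda>x. ?d l G' x - (\<Sum>j=1..m. ((-1) ^ (j - 1) / real j) *\<^sub>R ?d (j + l) G x))"
    by (intro continuous_intros cd cG') auto
  then have cI: "continuous_on W (\<lambda>x. (-1) ^ m *\<^sub>R ?I x)"
    by (rule continuous_on_eq) (simp add: eq)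
  have LI': "Lp_le p W (\<lambda>x. (-1) ^ m *\<^sub>R ?I x) A"
    by (rule Lp_le_mono[OF LI]) (use A in auto)
  have term_le: "Lp_le p W (\<lambda>x. ((-1) ^ (j - 1) / real j) *\<^sub>R ?d (j + l) G x) (2 ^ i / 2 ^ (j + l) * X)"
    if j: "j \<in> {1..m}" for j
  proof (rule Lp_le_mono)
    show "Lp_le p W (?d (j + l) G) (2 ^ i / 2 ^ (j + l) * X)"
      using Suc.IH[of "j + l"] j by (simp add: G_def X_def N mult.assoc)
    fix x
    have "\<bar>(-1) ^ (j - 1) / real j\<bar> \<le> 1" using j by (simp add: power_abs)
    then show "norm (((-1) ^ (j - 1) / real j) *\<^sub>R ?d (j + l) G x) \<le> norm (?d (j + l) G x)"
      unfolding norm_scaleR by (intro mult_left_le_one_le) auto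
  qed (use X in auto)
  have geo: "(\<Sum>j=1..m. 2 ^ i / 2 ^ (j + l) * X) \<le> 2 ^ i / 2 ^ l * X - A"
  proof -
    have g: "(\<Sum>j=1..m. 1 / (2::real) ^ j) = 1 - 1 / 2 ^ m" by (induction m) (auto simp: field_simps)
    have "(\<Sum>j=1..m. 2 ^ i / 2 ^ (j + l) * X) = 2 ^ i / 2 ^ l * X * (\<Sum>j=1..m. 1 / (2::real) ^ j)"
      unfolding sum_distrib_left by (intro sum.cong) (simp_all add: power_add field_simps)
    also have "\<dots> = 2 ^ i / 2 ^ l * X - 2 ^ i / 2 ^ l * X / 2 ^ m"
      unfolding g by (simp add: right_diff_distrib)
    also have "A \<le> 2 ^ i / 2 ^ l * X / 2 ^ m"
    proof -
      have "(2::real) ^ l * 2 ^ m \<le> 2 ^ N"  unfolding power_add[symmetric]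
        by (intro power_increasing) (auto simp: N)
      also have "\<dots> \<le> 4 ^ N" by (intro power_mono) auto
      also have "\<dots> \<le> 2 ^ i * 4 ^ N" by simp
      finally have "A * (2 ^ l * 2 ^ m) \<le> A * (2 ^ i * 4 ^ N)" using A by (intro mult_left_mono) auto
      then show ?thesis by (simp add: X_def field_simps)
    qed
    then show ?thesis unfolding calculation by simp
  qed
  have "Lp_le p W (\<lambda>x. (\<Sum>j=1..m. ((-1) ^ (j - 1) / real j) *\<^sub>R ?d (j + l) G x) + (-1) ^ m *\<^sub>R ?I x)
      (2 ^ i / 2 ^ l * X + A)"
  proof (cases "m = 0")
    case True
    then show ?thesis using LI' by (auto intro: Lp_le_mono simp: A X less_imp_le)
  next
    case False
    have "Lp_le p W (\<lambda>x. (\<Sum>j=1..m. ((-1) ^ (j - 1) / real j) *\<^sub>R ?d (j + l) G x) + (-1) ^ m *\<^sub>R ?I x)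
      ((\<Sum>j=1..m. 2 ^ i / 2 ^ (j + l) * X) + A)"
      using False X A
      by (intro Lp_le_add Lp_le_sum W p continuous_intros cI LI' cd term_le sum_pos) auto
    then show ?thesis
      by (rule Lp_le_mono) (use geo A X in \<open>auto intro!: add_nonneg_nonneg sum_nonneg\<close>)
  qed
  then have "Lp_le p W (?d l G') (2 ^ Suc i / 2 ^ l * X)"
  proof (rule Lp_le_mono)
    have "(2::real) ^ l \<le> 2 ^ N" by (intro power_increasing) (auto simp: N)
    also have "\<dots> \<le> 4 ^ N" by (intro power_mono) auto
    also have "\<dots> \<le> 2 ^ i * 4 ^ N" by simp
    finally have "A * 2 ^ l \<le> A * (2 ^ i * 4 ^ N)" using A by (intro mult_left_mono) auto
    then have "A \<le> 2 ^ i / 2 ^ l * X" by (simp add: X_def field_simps)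
    moreover have "2 ^ Suc i / 2 ^ l * X = 2 ^ i / 2 ^ l * X + 2 ^ i / 2 ^ l * X" by (simp add: field_simps)
    ultimately show "2 ^ i / 2 ^ l * X + A \<le> 2 ^ Suc i / 2 ^ l * X" by linarith
  qed (use eq A X in auto)
  then show ?case by (simp add: G'_def G_def X_def mult.assoc)
qed

section \<open>A global interpolation inequality with uniform constants\<close>

lemma sum_inverse_squares_le: "(\<Sum>j=1..n. 1 / (real j)\<^sup>2) \<le> 2"
proof -
  have "(\<Sum>j=1..Suc n. 1 / (real j)\<^sup>2) \<le> 2 - 1 / real (Suc n)" for n
  proof (induction n)
    case (Suc n)
    have "1 / (real n + 2)\<^sup>2 \<le> 1 / ((real n + 1) * (real n + 2))"
      by (intro divide_left_mono) (auto simp: power2_eq_square intro!: mult_right_mono)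
    also have "\<dots> = 1 / (real n + 1) - 1 / (real n + 2)" by (simp add: field_simps)
    finally show ?case using Suc.IH by (simp add: add_ac)
  qed simp
  from order_trans[OF this, of _ 2] show ?thesis by (cases n) auto
qed

lemma sum_inverse_squares_off_centre_le:
  assumes "c \<le> M"
  shows "(\<Sum>i\<in>{..M} - {c}. 1 / (real i - real c)\<^sup>2) \<le> 4"
proof -
  have split: "{..M} - {c} = {..<c} \<union> {c<..M}" using assms by auto
  have "(\<Sum>i\<in>{..M} - {c}. 1 / (real i - real c)\<^sup>2)
      = (\<Sum>i\<in>{..<c}. 1 / (real i - real c)\<^sup>2) + (\<Sum>i\<in>{c<..M}. 1 / (real i - real c)\<^sup>2)"
    unfolding split by (rule sum.union_disjoint) auto
  also have "(\<Sum>i\<in>{..<c}. 1 / (real i - real c)\<^sup>2) = (\<Sum>j=1..c. 1 / (real j)\<^sup>2)"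
    by (rule sum.reindex_bij_witness[of _ "\<lambda>j. c - j" "\<lambda>i. c - i"])
       (auto simp: of_nat_diff power2_commute)
  also have "(\<Sum>i\<in>{c<..M}. 1 / (real i - real c)\<^sup>2) = (\<Sum>j=1..M - c. 1 / (real j)\<^sup>2)"
    by (rule sum.reindex_bij_witness[of _ "\<lambda>j. c + j" "\<lambda>i. i - c"])
       (auto simp: of_nat_diff)
  finally show ?thesis
    using sum_inverse_squares_le[of c] sum_inverse_squares_le[of "M - c"] by simp
qed

lemma has_vector_derivative_dilation:
  fixes f :: "real \<Rightarrow> 'b::real_normed_vector"
  assumes "\<And>t. (f has_vector_derivative f' t) (at t)"
  shows "((\<lambda>h. f (j * h)) has_vector_derivative j *\<^sub>R f' (j * h)) (at h)"
proof -
  have "((\<lambda>h. j * h) has_vector_derivative j) (at h)"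
    by (auto intro!: derivative_eq_intros)
  from vector_diff_chain_at[OF this assms] show ?thesis by (simp add: o_def)
qed

text \<open>
  Integration by parts against the hat function \<open>1 - \<bar>h\<bar>\<close> on
  \<open>[-1, 1]\<close>, folded to \<open>[0, 1]\<close>. The gain \<open>1 /
  j\<^sup>2\<close> for \<open>j \<noteq> 0\<close> is summable over the integers; a single
  integration would only gain \<open>1 / j\<close>, whose sum over \<open>\<bar>j\<bar> \<le>
  M\<close> grows with \<open>M\<close>.
\<close>
lemma has_integral_hat_second_derivative:
  fixes u :: "real \<Rightarrow> 'b::banach"
  assumes u: "\<And>t. (u has_vector_derivative u' t) (at t)"
    and u': "\<And>t. (u' has_vector_derivative u'' t) (at t)"
  shows "((\<lambda>h. (1 - h) *\<^sub>R (u'' (j * h) + u'' (- j * h))) has_integral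
      (if j = 0 then u'' 0 else (1 / j\<^sup>2) *\<^sub>R (u j + u (- j) - 2 *\<^sub>R u 0))) {0..1}"
proof (cases "j = 0")
  case True
  have "((\<lambda>h. h - h\<^sup>2 / 2) has_vector_derivative 1 - h) (at h within {0..1})" for h :: real
    by (auto intro!: derivative_eq_intros has_vector_derivative_at_within
        simp flip: has_real_derivative_iff_has_vector_derivative)
  from fundamental_theorem_of_calculus[OF _ this]
  have "((\<lambda>h. 1 - h) has_integral (1 / 2)) {0..1::real}" by simp
  from has_integral_scaleR_left[OF this, of "2 *\<^sub>R u'' 0"] True show ?thesis
    by (simp add: scaleR_2)
next
  case False
  define P where "P h = (1 / j) *\<^sub>R ((1 - h) *\<^sub>R (u' (j * h) - u' (- j * h)))
      + (1 / j\<^sup>2) *\<^sub>R (u (j * h) + u (- j * h))" for h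
  have lin: "((\<lambda>h. 1 - h) has_vector_derivative - 1) (at h)" for h :: real
    by (auto intro!: derivative_eq_intros)
  have "(P has_vector_derivative (1 - h) *\<^sub>R (u'' (j * h) + u'' (- j * h))) (at h within {0..1})" for h
  proof -
    have "(P has_vector_derivative
        (1 / j) *\<^sub>R ((1 - h) *\<^sub>R (j *\<^sub>R u'' (j * h) - (- j) *\<^sub>R u'' (- j * h)) + (- 1) *\<^sub>R (u' (j * h) - u' (- j * h)))
        + (1 / j\<^sup>2) *\<^sub>R (j *\<^sub>R u' (j * h) + (- j) *\<^sub>R u' (- j * h))) (at h)"
      unfolding P_def
      by (intro derivative_intros has_vector_derivative_dilation u u'
          bounded_linear.has_vector_derivative[OF bounded_linear_scaleR_right]
          bounded_bilinear.has_vector_derivative[OF bounded_bilinear_scaleR lin])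
    also have "(1 / j) *\<^sub>R ((1 - h) *\<^sub>R (j *\<^sub>R u'' (j * h) - (- j) *\<^sub>R u'' (- j * h)) + (- 1) *\<^sub>R (u' (j * h) - u' (- j * h)))
        + (1 / j\<^sup>2) *\<^sub>R (j *\<^sub>R u' (j * h) + (- j) *\<^sub>R u' (- j * h))
        = (1 - h) *\<^sub>R (u'' (j * h) + u'' (- j * h))"
      using False by (simp add: algebra_simps power2_eq_square)
    finally show ?thesis by (rule has_vector_derivative_at_within)
  qed
  from fundamental_theorem_of_calculus[OF _ this]
  have "((\<lambda>h. (1 - h) *\<^sub>R (u'' (j * h) + u'' (- j * h))) has_integral P 1 - P 0) {0..1}" by simp
  also have "P 1 - P 0 = (1 / j\<^sup>2) *\<^sub>R (u j + u (- j) - 2 *\<^sub>R u 0)"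
    by (simp add: P_def algebra_simps scaleR_2)
  finally show ?thesis using False by simp
qed

text \<open>
  The difference of order \<open>M\<close> of \<open>u''\<close> with step \<open>h\<close>
  and base point \<open>- c h\<close> is a combination of the values \<open>u'' (j h)\<close>.
  Averaging over \<open>h\<close> leaves \<open>u'' 0\<close> for \<open>j = 0\<close> and
  removes both derivatives from all the other terms.
\<close>
lemma second_derivative_eq_differences:
  fixes u :: "real \<Rightarrow> 'b::banach"
  assumes u: "\<And>t. (u has_vector_derivative u' t) (at t)"
    and u': "\<And>t. (u' has_vector_derivative u'' t) (at t)"
    and "c \<le> M"
  shows "((-1) ^ (M + c) * real (M choose c)) *\<^sub>R u'' 0 =
     integral {0..1} (\<lambda>h. (1 - h) *\<^sub>R (idiff (replicate M h) u'' (- real c * h)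
        + idiff (replicate M (- h)) u'' (real c * h)))
   - (\<Sum>i\<in>{..M} - {c}. ((-1) ^ (M + i) * real (M choose i) / (real i - real c)\<^sup>2) *\<^sub>R
        (u (real i - real c) + u (- (real i - real c)) - 2 *\<^sub>R u 0))"
proof -
  define a where "a i = (-1) ^ (M + i) * real (M choose i)" for i
  define K where "K i = (if real i - real c = 0 then u'' 0 else (1 / (real i - real c)\<^sup>2) *\<^sub>R
        (u (real i - real c) + u (- (real i - real c)) - 2 *\<^sub>R u 0))" for i
  have "((\<lambda>h. \<Sum>i\<le>M. a i *\<^sub>R ((1 - h) *\<^sub>R (u'' ((real i - real c) * h) + u'' (- (real i - real c) * h))))
      has_integral (\<Sum>i\<le>M. a i *\<^sub>R K i)) {0..1}"
    unfolding K_def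
    by (intro has_integral_sum has_integral_cmul has_integral_hat_second_derivative[OF u u']) auto
  also have "(\<lambda>h. \<Sum>i\<le>M. a i *\<^sub>R ((1 - h) *\<^sub>R (u'' ((real i - real c) * h) + u'' (- (real i - real c) * h))))
     = (\<lambda>h. (1 - h) *\<^sub>R (idiff (replicate M h) u'' (- real c * h)
        + idiff (replicate M (- h)) u'' (real c * h)))"
    unfolding idiff_replicate a_def[symmetric] sum.distrib[symmetric] scaleR_sum_right
    by (intro ext sum.cong) (simp_all add: algebra_simps)
  finally have "integral {0..1} (\<lambda>h. (1 - h) *\<^sub>R (idiff (replicate M h) u'' (- real c * h)
        + idiff (replicate M (- h)) u'' (real c * h))) = (\<Sum>i\<le>M. a i *\<^sub>R K i)"
    by (rule integral_unique)
  also have "\<dots> = a c *\<^sub>R K c + (\<Sum>i\<in>{..M} - {c}. a i *\<^sub>R K i)"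
    using \<open>c \<le> M\<close> by (intro sum.remove) auto
  also have "(\<Sum>i\<in>{..M} - {c}. a i *\<^sub>R K i) = (\<Sum>i\<in>{..M} - {c}. (a i / (real i - real c)\<^sup>2) *\<^sub>R
        (u (real i - real c) + u (- (real i - real c)) - 2 *\<^sub>R u 0))"
    by (intro sum.cong) (auto simp: K_def)
  finally show ?thesis by (simp add: a_def K_def)
qed

text \<open>
  For \<open>c = M div 2\<close> the coefficient of \<open>u'' 0\<close> in the preceding
  formula is, up to sign, the largest binomial coefficient. After division by it the other
  coefficients are at most \<open>1\<close>, so the constants do not depend on
  \<open>M\<close>. The average itself is a mean of differences of order \<open>M\<close> of
  \<open>\<partial>\<^sub>v\<^sup>2 F\<close>, bounded by
  \<open>\<partial>\<^sub>v\<^sup>M\<^sup>+\<^sup>2 F\<close>.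
\<close>
lemma Lp_le_second_dir_deriv:
  fixes F :: "'a::euclidean_space \<Rightarrow> 'b::banach"
  assumes p: "1 \<le> p" and A: "0 < A" and B: "0 < B" and sm: "smooth_on UNIV F"
    and F0: "Lp_le p UNIV F A" and FN: "Lp_le p UNIV ((dir_deriv v ^^ (M + 2)) F) B"
  shows "Lp_le p UNIV (dir_deriv v (dir_deriv v F)) (16 * A + 2 * B)"
proof -
  define c where "c = M div 2"
  define D where "D = dir_deriv v (dir_deriv v F)"
  define a where "a i = (-1) ^ (M + i) * real (M choose i)" for i
  define b where "b = real (M choose c)"
  have cM: "c \<le> M" by (simp add: c_def)
  have b: "b \<ge> 1" using cM by (simp add: b_def Suc_leI)
  have ab: "\<bar>a i\<bar> \<le> b" for i
    using binomial_maximum[of M i] by (simp add: a_def b_def c_def abs_mult power_abs)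
  have D: "smooth_on UNIV D" unfolding D_def by (intro smooth_on_dir_deriv sm)
  have contF: "continuous_on UNIV F" and contD: "continuous_on UNIV D"
    using sm D by (auto intro: smooth_on_imp_continuous_on)
  let ?R = "\<lambda>x h. idiff (replicate M h) (\<lambda>t. D (x + t *\<^sub>R v)) (- real c * h)"
  let ?R' = "\<lambda>x h. idiff (replicate M (- h)) (\<lambda>t. D (x + t *\<^sub>R v)) (real c * h)"
  let ?I = "\<lambda>x. integral {0..1} (\<lambda>h. (1 - h) *\<^sub>R (?R x h + ?R' x h))"
  let ?j = "\<lambda>i. real i - real c"
  let ?K = "\<lambda>i x. F (x + ?j i *\<^sub>R v) + F (x + (- ?j i) *\<^sub>R v) - 2 *\<^sub>R F x"
  have DN: "Lp_le p UNIV ((dir_deriv v ^^ length (replicate M h)) D) B" for h :: real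
  proof -
    have "(dir_deriv v ^^ M) D = (dir_deriv v ^^ (M + 2)) F"
      unfolding funpow_add by (simp add: D_def numeral_2_eq_2)
    then show ?thesis using FN by simp
  qed
  have eq: "(a c / b\<^sup>2) *\<^sub>R ?I x + (\<Sum>i\<in>{..M} - {c}. (- (a c * a i) / (b * ?j i)\<^sup>2) *\<^sub>R ?K i x) = D x" for x
  proof -
    have 1: "((\<lambda>t. G (x + t *\<^sub>R v)) has_vector_derivative dir_deriv v G (x + t *\<^sub>R v)) (at t)"
      if "smooth_on UNIV G" for G :: "'a \<Rightarrow> 'b" and t
      by (rule has_vector_derivative_along_line[OF that]) simp
    have "a c *\<^sub>R D x = ?I x - (\<Sum>i\<in>{..M} - {c}. (a i / (?j i)\<^sup>2) *\<^sub>R ?K i x)"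
      using second_derivative_eq_differences[OF 1[OF sm] 1[OF smooth_on_dir_deriv[OF sm]] cM]
      by (simp add: a_def D_def)
    then have "(a c / b\<^sup>2) *\<^sub>R (a c *\<^sub>R D x)
        = (a c / b\<^sup>2) *\<^sub>R (?I x - (\<Sum>i\<in>{..M} - {c}. (a i / (?j i)\<^sup>2) *\<^sub>R ?K i x))" by simp
    moreover have "a c * a c = b\<^sup>2"
      by (simp add: a_def b_def power2_eq_square power_add[symmetric] mult_ac)
    then have "(a c / b\<^sup>2) *\<^sub>R (a c *\<^sub>R D x) = D x" using b by simp
    moreover have "(a c / b\<^sup>2) *\<^sub>R (y - (\<Sum>i\<in>S. (a i / (?j i)\<^sup>2) *\<^sub>R K i))
        = (a c / b\<^sup>2) *\<^sub>R y + (\<Sum>i\<in>S. (- (a c * a i) / (b * ?j i)\<^sup>2) *\<^sub>R K i)" for y :: 'b and K S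
      by (simp add: scaleR_right_diff_distrib scaleR_sum_right sum_negf power_mult_distrib)
    ultimately show ?thesis by metis
  qed
  have contK: "continuous_on UNIV (?K i)" for i
    by (intro continuous_intros continuous_on_compose2[OF contF]) auto
  have LK: "Lp_le p UNIV (?K i) (4 * A)" for i
  proof -
    have t: "Lp_le p UNIV (\<lambda>x. F (x + z)) A" for z
      using A by (intro Lp_le_translation[of UNIV] contF F0 p) auto
    have c: "continuous_on UNIV (\<lambda>x. F (x + z))" for z
      by (intro continuous_on_compose2[OF contF] continuous_intros) auto
    have "Lp_le p UNIV (?K i) ((A + A) + \<bar>2\<bar> * A)"
      using A by (intro Lp_le_diff Lp_le_add Lp_le_scaleR t c contF F0 p continuous_intros) auto
    then show ?thesis by simp
  qed
  have LI: "Lp_le p UNIV ?I (2 * B)"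
  proof (rule Lp_le_integral[OF _ _ p])
    have c: "continuous_on (UNIV \<times> {0..1}) (\<lambda>z. idiff (map (\<lambda>f. f z) (replicate M (\<lambda>z. s * snd z)))
            (\<lambda>t. D (fst z + t *\<^sub>R v)) (r * snd z))" for s r
      by (rule continuous_on_idiff[OF contD]) (auto intro!: continuous_intros)
    show "continuous_on (UNIV \<times> {0..1}) (\<lambda>(x, h). (1 - h) *\<^sub>R (?R x h + ?R' x h))"
      using c[of 1 "- real c"] c[of "-1" "real c"]
      by (auto simp: case_prod_unfold intro!: continuous_intros)
    fix h :: real assume h: "h \<in> {0..1}"
    have cl: "continuous_on UNIV (\<lambda>x. idiff hs (\<lambda>t. D (x + t *\<^sub>R v)) s)" for hs s
      by (rule continuous_on_idiff_line[OF contD]) auto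
    have l: "Lp_le p UNIV (\<lambda>x. idiff (replicate M s) (\<lambda>t. D (x + t *\<^sub>R v)) r) B" if "\<bar>s\<bar> \<le> 1" for s r
      using that B by (intro Lp_le_idiff[OF _ _ p _ _ D DN _ order_refl]) auto
    have "Lp_le p UNIV (\<lambda>x. ?R x h + ?R' x h) (B + B)"
      using h B by (intro Lp_le_add cl p l) auto
    then show "Lp_le p UNIV (\<lambda>x. (1 - h) *\<^sub>R (?R x h + ?R' x h)) (2 * B)"
      by (rule Lp_le_mono) (use h B in \<open>auto intro: mult_left_le_one_le\<close>)
  qed (use B in auto)
  have LI': "Lp_le p UNIV (\<lambda>x. (a c / b\<^sup>2) *\<^sub>R ?I x) (2 * B)"
  proof (rule Lp_le_mono[OF LI])
    have "\<bar>a c\<bar> \<le> b\<^sup>2" using ab[of c] b by (smt (verit) power2_eq_square mult_left_le_one_le mult_le_cancel_left1)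
    then have "\<bar>a c / b\<^sup>2\<bar> \<le> 1" using b by (simp add: field_simps)
    then show "norm ((a c / b\<^sup>2) *\<^sub>R ?I x) \<le> norm (?I x)" for x
      unfolding norm_scaleR by (intro mult_left_le_one_le) auto
  qed (use B in auto)
  have LS: "Lp_le p UNIV (\<lambda>x. (- (a c * a i) / (b * ?j i)\<^sup>2) *\<^sub>R ?K i x) (4 * A * (1 / (?j i)\<^sup>2))"
    if "i \<in> {..M} - {c}" for i
  proof (rule Lp_le_mono)
    let ?s = "- (a c * a i) / (b * ?j i)\<^sup>2"
    show "Lp_le p UNIV (\<lambda>x. ?s *\<^sub>R ?K i x) (\<bar>?s\<bar> * (4 * A))"
      using A by (intro Lp_le_scaleR contK LK p) auto
    have "\<bar>a c\<bar> * \<bar>a i\<bar> \<le> b * b" using b by (intro mult_mono ab) auto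
    then have "(\<bar>a c\<bar> * \<bar>a i\<bar>) / (b\<^sup>2 * (?j i)\<^sup>2) \<le> b\<^sup>2 / (b\<^sup>2 * (?j i)\<^sup>2)"
      by (intro divide_right_mono) (auto simp: power2_eq_square)
    then have "\<bar>?s\<bar> \<le> 1 / (?j i)\<^sup>2"
      using b by (simp add: abs_mult power_mult_distrib)
    then have "(4 * A) * \<bar>?s\<bar> \<le> (4 * A) * (1 / (?j i)\<^sup>2)"
      using A by (intro mult_left_mono) auto
    then show "\<bar>?s\<bar> * (4 * A) \<le> 4 * A * (1 / (?j i)\<^sup>2)"
      by (simp only: mult.commute[of "\<bar>?s\<bar>"])
  qed (use A in auto)
  have cI: "continuous_on UNIV (\<lambda>x. (a c / b\<^sup>2) *\<^sub>R ?I x)"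
  proof -
    have "continuous_on UNIV (\<lambda>x. D x - (\<Sum>i\<in>{..M} - {c}. (- (a c * a i) / (b * ?j i)\<^sup>2) *\<^sub>R ?K i x))"
      by (intro continuous_on_diff contD continuous_on_sum continuous_on_scaleR continuous_on_const contK)
    then show ?thesis by (rule continuous_on_eq) (simp only: diff_eq_eq eq)
  qed
  have "Lp_le p UNIV D (16 * A + 2 * B)"
  proof (cases "{..M} - {c} = {}")
    case True
    have "(a c / b\<^sup>2) *\<^sub>R ?I x = D x" for x using eq[of x] unfolding True by simp
    then show ?thesis using A B by (intro Lp_le_mono[OF LI']) auto
  next
    case False
    have "Lp_le p UNIV (\<lambda>x. (a c / b\<^sup>2) *\<^sub>R ?I x
        + (\<Sum>i\<in>{..M} - {c}. (- (a c * a i) / (b * ?j i)\<^sup>2) *\<^sub>R ?K i x))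
        (2 * B + (\<Sum>i\<in>{..M} - {c}. 4 * A * (1 / (?j i)\<^sup>2)))"
      using False A B
      by (intro Lp_le_add Lp_le_sum LI' LS p cI continuous_on_sum continuous_on_scaleR continuous_on_const
          contK sum_pos) auto
    then have "Lp_le p UNIV D (2 * B + (\<Sum>i\<in>{..M} - {c}. 4 * A * (1 / (?j i)\<^sup>2)))"
      by (simp only: eq)
    then show ?thesis
    proof (rule Lp_le_mono)
      have "(\<Sum>i\<in>{..M} - {c}. 4 * A * (1 / (?j i)\<^sup>2)) = 4 * A * (\<Sum>i\<in>{..M} - {c}. 1 / (?j i)\<^sup>2)"
        by (simp only: sum_distrib_left)
      also have "\<dots> \<le> 4 * A * 4"
        using A by (intro mult_left_mono sum_inverse_squares_off_centre_le cM) auto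
      finally show "2 * B + (\<Sum>i\<in>{..M} - {c}. 4 * A * (1 / (?j i)\<^sup>2)) \<le> 16 * A + 2 * B" by simp
    qed (use A B in \<open>auto intro!: add_nonneg_nonneg sum_nonneg\<close>)
  qed
  then show ?thesis by (simp add: D_def)
qed

text \<open>
  The Landau--Kolmogorov inequality at unit scale, with constants independent of
  \<open>N\<close>. The bound for \<open>\<partial>\<^sub>v\<^sup>2 F\<close> passes to
  \<open>\<partial>\<^sub>v F\<close> by Taylor's formula of order two.
\<close>
lemma Lp_le_dir_deriv:
  fixes F :: "'a::euclidean_space \<Rightarrow> 'b::banach"
  assumes p: "1 \<le> p" and A: "0 < A" and B: "0 < B" and sm: "smooth_on UNIV F"
    and F0: "Lp_le p UNIV F A" and FN: "Lp_le p UNIV ((dir_deriv v ^^ N) F) B" and N: "1 \<le> N"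
  shows "Lp_le p UNIV (dir_deriv v F) (18 * A + 2 * B)"
proof (cases "N = 1")
  case True
  then show ?thesis using FN A B by (auto intro: Lp_le_mono)
next
  case False
  define D where "D = dir_deriv v (dir_deriv v F)"
  have "N = (N - 2) + 2" using N False by simp
  then have D: "Lp_le p UNIV D (16 * A + 2 * B)"
    unfolding D_def using Lp_le_second_dir_deriv[OF p A B sm F0, where v = v and M = "N - 2"] FN by simp
  have smD: "smooth_on UNIV D" unfolding D_def by (intro smooth_on_dir_deriv sm)
  have contF: "continuous_on UNIV F" and contD: "continuous_on UNIV D"
    using sm smD by (auto intro: smooth_on_imp_continuous_on)
  have contF': "continuous_on UNIV (dir_deriv v F)"
    using sm by (intro smooth_on_imp_continuous_on smooth_on_dir_deriv)
  let ?I = "\<lambda>x. integral {0..1} (\<lambda>h. (1 - h) *\<^sub>R D (x + h *\<^sub>R v))"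
  have eq: "dir_deriv v F x = F (x + v) - F x - ?I x" for x
  proof -
    have 1: "((\<lambda>t. G (x + t *\<^sub>R v)) has_vector_derivative dir_deriv v G (x + t *\<^sub>R v)) (at t)"
      if "smooth_on UNIV G" for G :: "'a \<Rightarrow> 'b" and t
      by (rule has_vector_derivative_along_line[OF that]) simp
    have lin: "((\<lambda>h. 1 - h) has_vector_derivative - 1) (at h)" for h :: real
      by (auto intro!: derivative_eq_intros)
    have "((\<lambda>h. (1 - h) *\<^sub>R dir_deriv v F (x + h *\<^sub>R v) + F (x + h *\<^sub>R v)) has_vector_derivative
        ((1 - h) *\<^sub>R D (x + h *\<^sub>R v) + (- 1) *\<^sub>R dir_deriv v F (x + h *\<^sub>R v)) + dir_deriv v F (x + h *\<^sub>R v))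
        (at h within {0..1})" for h
      unfolding D_def
      by (rule has_vector_derivative_at_within, intro has_vector_derivative_add
          1[OF sm] 1[OF smooth_on_dir_deriv[OF sm]] bounded_bilinear.has_vector_derivative[OF bounded_bilinear_scaleR lin])
    from fundamental_theorem_of_calculus[OF _ this]
    have "((\<lambda>h. (1 - h) *\<^sub>R D (x + h *\<^sub>R v)) has_integral F (x + v) - (dir_deriv v F x + F x)) {0..1}"
      by simp
    then have "?I x = F (x + v) - (dir_deriv v F x + F x)" by (rule integral_unique)
    then show ?thesis by simp
  qed
  have cv: "continuous_on UNIV (\<lambda>x. F (x + v))"
    by (intro continuous_on_compose2[OF contF] continuous_intros) auto
  have LI: "Lp_le p UNIV ?I (16 * A + 2 * B)"
  proof (rule Lp_le_integral[OF _ _ p])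
    show "continuous_on (UNIV \<times> {0..1}) (\<lambda>(x, h). (1 - h) *\<^sub>R D (x + h *\<^sub>R v))"
      by (auto simp: case_prod_unfold intro!: continuous_intros continuous_on_compose2[OF contD])
    fix h :: real assume h: "h \<in> {0..1}"
    have "Lp_le p UNIV (\<lambda>x. D (x + h *\<^sub>R v)) (16 * A + 2 * B)"
      using A B by (intro Lp_le_translation[of UNIV] contD D p) auto
    then show "Lp_le p UNIV (\<lambda>x. (1 - h) *\<^sub>R D (x + h *\<^sub>R v)) (16 * A + 2 * B)"
      by (rule Lp_le_mono) (use h A B in \<open>auto intro: mult_left_le_one_le\<close>)
  qed (use A B in auto)
  have cI: "continuous_on UNIV ?I"
  proof -
    have "continuous_on UNIV (\<lambda>x. F (x + v) - F x - dir_deriv v F x)"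
      by (intro continuous_intros cv contF contF')
    then show ?thesis by (rule continuous_on_eq) (simp add: eq)
  qed
  have "Lp_le p UNIV (dir_deriv v F) ((A + A) + (16 * A + 2 * B))"
    unfolding eq[abs_def] using A B
    by (intro Lp_le_diff LI cI cv contF F0 p continuous_intros Lp_le_translation[of UNIV]) auto
  then show ?thesis by simp
qed

section \<open>Multiindices and words of coordinates\<close>

lemma smooth_on_subset: "smooth_on U f \<Longrightarrow> V \<subseteq> U \<Longrightarrow> smooth_on V f"
proof -
  have "higher_differentiable_on U f n \<Longrightarrow> V \<subseteq> U \<Longrightarrow> higher_differentiable_on V f n" for n
  proof (induction n arbitrary: f)
    case 0
    then show ?case by (auto intro: continuous_on_subset)
  next
    case (Suc n)
    then show ?case by (auto simp: subset_iff)
  qed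
  then show "smooth_on U f \<Longrightarrow> V \<subseteq> U \<Longrightarrow> smooth_on V f" by (auto simp: smooth_on_def)
qed

lemma foldr_partial_deriv_eq:
  "foldr partial_deriv w f = foldr dir_deriv (map (\<lambda>i. axis i 1) w) f"
  by (induction w) (auto simp: partial_deriv_eq_dir_deriv)

lemma smooth_on_foldr_partial_deriv: "smooth_on U f \<Longrightarrow> smooth_on U (foldr partial_deriv w f)"
  unfolding foldr_partial_deriv_eq by (rule smooth_on_foldr_dir_deriv)

lemma foldr_partial_deriv_replicate:
  "foldr partial_deriv (replicate i d @ w) f = (dir_deriv (axis d 1) ^^ i) (foldr partial_deriv w f)"
  by (induction i) (auto simp: partial_deriv_eq_dir_deriv)

text \<open>
  Derivatives are indexed by words of coordinates rather than by multiindices: prefixing a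
  letter is one more partial derivative, which is the operation the inductions below perform.
\<close>
definition mi_word :: "nat^'n::finite \<Rightarrow> 'n list" where
  "mi_word \<alpha> = concat (map (\<lambda>i. replicate (\<alpha> $ i) i) coordinates)"

lemma distinct_coordinates: "distinct (coordinates :: 'n::finite list)"
  and set_coordinates: "set (coordinates :: 'n::finite list) = UNIV"
proof -
  have "\<exists>xs :: 'n list. distinct xs \<and> set xs = UNIV"
    using finite_distinct_list[of "UNIV :: 'n set"] by auto
  from someI_ex[OF this] show "distinct (coordinates :: 'n list)" "set (coordinates :: 'n list) = UNIV"
    unfolding coordinates_def by auto
qed

lemma length_coordinates: "length (coordinates :: 'n::finite list) = CARD('n)"
proof -
  have "length (coordinates :: 'n list) = card (set (coordinates :: 'n list))"
    by (rule distinct_card[OF distinct_coordinates, symmetric])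
  then show ?thesis by (simp add: set_coordinates)
qed

lemma mi_deriv_eq_foldr: "mi_deriv \<alpha> f = foldr partial_deriv (mi_word \<alpha>) f"
proof -
  have "foldr (\<lambda>i. partial_deriv i ^^ (\<alpha> $ i)) cs f
      = foldr partial_deriv (concat (map (\<lambda>i. replicate (\<alpha> $ i) i) cs)) f" for cs
    by (induction cs) (simp_all add: foldr_partial_deriv_replicate partial_deriv_eq_dir_deriv)
  then show ?thesis by (simp add: mi_deriv_def mi_word_def)
qed

lemma length_mi_word: "length (mi_word \<alpha>) = mi_order \<alpha>"
  unfolding mi_word_def mi_order_def
  by (simp add: length_concat o_def sum_list_distinct_conv_sum_set[OF distinct_coordinates] set_coordinates)

lemma mset_mi_word_count:
  fixes w :: "'n::finite list"
  shows "mset (mi_word (\<chi> i. count (mset w) i)) = mset w"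
proof (rule multiset_eqI)
  fix d :: 'n
  have "count (mset (concat (map (\<lambda>i. replicate (a i) i) cs))) d = (if d \<in> set cs then a d else 0)"
    if "distinct cs" for cs :: "'n list" and a
    using that by (induction cs) auto
  from this[OF distinct_coordinates] show "count (mset (mi_word (\<chi> i. count (mset w) i))) d = count (mset w) d"
    by (simp add: mi_word_def set_coordinates)
qed

definition derivs_le ::
    "ennreal \<Rightarrow> (real^'n::finite) set \<Rightarrow> (real^'n \<Rightarrow> 'b::real_normed_vector) \<Rightarrow> nat \<Rightarrow> real \<Rightarrow> bool" where
  "derivs_le p W f q B \<longleftrightarrow> (\<forall>w. length w = q \<longrightarrow> Lp_le p W (foldr partial_deriv w f) B)"

lemma derivs_le_iff:
  fixes f :: "real^'n::finite \<Rightarrow> 'b::real_normed_vector"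
  assumes "open W" "smooth_on W f" "1 \<le> p" "0 \<le> B"
  shows "derivs_le p W f q B \<longleftrightarrow> (\<forall>\<alpha>. mi_order \<alpha> = q \<longrightarrow> Lp_norm p W (mi_deriv \<alpha> f) \<le> ennreal B)"
proof
  have norm_iff: "Lp_norm p W (mi_deriv \<alpha> f) \<le> ennreal B \<longleftrightarrow> Lp_le p W (mi_deriv \<alpha> f) B" for \<alpha>
    unfolding mi_deriv_eq_foldr
    by (intro Lp_norm_le_iff assms smooth_on_imp_continuous_on smooth_on_foldr_partial_deriv)
  show "derivs_le p W f q B \<Longrightarrow> \<forall>\<alpha>. mi_order \<alpha> = q \<longrightarrow> Lp_norm p W (mi_deriv \<alpha> f) \<le> ennreal B"
    unfolding norm_iff by (simp add: derivs_le_def mi_deriv_eq_foldr length_mi_word)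
  assume *: "\<forall>\<alpha>. mi_order \<alpha> = q \<longrightarrow> Lp_norm p W (mi_deriv \<alpha> f) \<le> ennreal B"
  show "derivs_le p W f q B"
    unfolding derivs_le_def
  proof (intro allI impI)
    fix w :: "'n list" assume w: "length w = q"
    define \<alpha> where "\<alpha> = (\<chi> i. count (mset w) i)"
    have m: "mset (mi_word \<alpha>) = mset w" unfolding \<alpha>_def by (rule mset_mi_word_count)
    have "mi_order \<alpha> = q" using mset_eq_length[OF m] w by (simp add: length_mi_word)
    then have "Lp_le p W (mi_deriv \<alpha> f) B" using * norm_iff by blast
    then show "Lp_le p W (foldr partial_deriv w f) B"
    proof (rule Lp_le_mono)
      fix x assume "x \<in> W"
      then have "foldr partial_deriv w f x = mi_deriv \<alpha> f x"
        unfolding mi_deriv_eq_foldr foldr_partial_deriv_eq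
        by (intro foldr_dir_deriv_mset_eq[OF assms(1,2)]) (simp_all add: m)
      then show "norm (foldr partial_deriv w f x) \<le> norm (mi_deriv \<alpha> f x)" by simp
    qed (use assms in auto)
  qed
qed

lemma derivs_le_mono:
  assumes "derivs_le p W f q B" "V \<subseteq> W" "B \<le> C" "0 \<le> B"
  shows "derivs_le p V f q C"
  using assms by (auto simp: derivs_le_def intro: Lp_le_mono)

section \<open>Interpolation between two orders\<close>

text \<open>
  One step of the induction raises the order by one in a single coordinate direction. The
  direction is scaled by \<open>1 / S\<close>, which makes the two terms of the interpolation
  inequality equally large: both are multiples of \<open>C S\<^sup>k\<^sup>+\<^sup>i\<close>.
  Because the inequality holds with constants independent of the distance to \<open>L\<close>,
  the accumulated constant is \<open>20\<^sup>i\<close> even if \<open>L\<close> is much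
  larger than \<open>k + i\<close>.
\<close>
lemma derivs_le_interpolate:
  fixes f :: "real^'n::finite \<Rightarrow> 'b::banach"
  assumes sm: "smooth_on UNIV f" and p: "1 \<le> p" and C: "0 < C" and S: "0 < S"
    and k: "derivs_le p UNIV f k (C * S ^ k)" and L: "derivs_le p UNIV f L (C * S ^ L)"
  shows "k + i \<le> L \<Longrightarrow> derivs_le p UNIV f (k + i) (C * 20 ^ i * S ^ (k + i))"
proof (induction i)
  case 0
  then show ?case using k by simp
next
  case (Suc i)
  show ?case
    unfolding derivs_le_def
  proof (intro allI impI)
    fix w :: "'n list" assume "length w = k + Suc i"
    then obtain d w' where w: "w = d # w'" and w': "length w' = k + i" by (cases w) auto
    define F where "F = foldr partial_deriv w' f"
    have F: "smooth_on UNIV F" unfolding F_def by (rule smooth_on_foldr_partial_deriv[OF sm])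
    define e :: "real^'n" where "e = axis d 1"
    define v where "v = (1 / S) *\<^sub>R e"
    define N where "N = L - (k + i)"
    have N: "1 \<le> N" "L = N + (k + i)" using Suc.prems by (auto simp: N_def)
    define A where "A = C * 20 ^ i * S ^ (k + i)"
    have A: "A > 0" using C S by (simp add: A_def)
    have FA: "Lp_le p UNIV F A"
      using Suc w' by (auto simp: F_def A_def derivs_le_def)
    have "length (replicate N d @ w') = L" using w' N by simp
    from L[unfolded derivs_le_def, rule_format, OF this]
    have "Lp_le p UNIV ((dir_deriv e ^^ N) F) (C * S ^ L)"
      by (simp only: foldr_partial_deriv_replicate F_def e_def)
    then have "Lp_le p UNIV (\<lambda>x. (1 / S) ^ N *\<^sub>R (dir_deriv e ^^ N) F x) (\<bar>(1 / S) ^ N\<bar> * (C * S ^ L))"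
      using C S by (intro Lp_le_scaleR p smooth_on_imp_continuous_on smooth_on_iterated_dir_deriv F) auto
    then have "Lp_le p UNIV ((dir_deriv v ^^ N) F) A"
    proof (rule Lp_le_mono)
      have "\<bar>(1 / S) ^ N\<bar> * (C * S ^ L) = C * S ^ (k + i)"
        using S by (simp add: N(2) power_add power_divide)
      also have "\<dots> \<le> C * S ^ (k + i) * 20 ^ i" using C S by simp
      finally show "\<bar>(1 / S) ^ N\<bar> * (C * S ^ L) \<le> A" by (simp add: A_def mult_ac)
    qed (use C S in \<open>auto simp: v_def iterated_dir_deriv_scaleR[OF open_UNIV F]\<close>)
    from Lp_le_dir_deriv[OF p A A F FA this N(1)]
    have "Lp_le p UNIV (dir_deriv v F) (18 * A + 2 * A)" .
    then have "Lp_le p UNIV (\<lambda>x. S *\<^sub>R dir_deriv v F x) (\<bar>S\<bar> * (18 * A + 2 * A))"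
      using A by (intro Lp_le_scaleR p smooth_on_imp_continuous_on smooth_on_dir_deriv F) auto
    then show "Lp_le p UNIV (foldr partial_deriv w f) (C * 20 ^ Suc i * S ^ (k + Suc i))"
    proof (rule Lp_le_mono)
      show "norm (foldr partial_deriv w f x) \<le> norm (S *\<^sub>R dir_deriv v F x)" for x
        using iterated_dir_deriv_scaleR[OF open_UNIV F, where x = x and c = "1 / S" and v = e and i = 1] S
        by (simp add: w partial_deriv_eq_dir_deriv F_def v_def e_def)
      show "\<bar>S\<bar> * (18 * A + 2 * A) \<le> C * 20 ^ Suc i * S ^ (k + Suc i)"
        using S by (simp add: A_def algebra_simps)
    qed (use S A in auto)
  qed
qed

lemma Lp_le_iterated_dir_deriv_local:
  fixes G :: "'a::euclidean_space \<Rightarrow> 'b::banach"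
  assumes "open V" "open W" and p: "1 \<le> p" and Y: "0 < Y" and S: "0 < S"
    and sm: "smooth_on V G"
    and rng: "\<And>x t. x \<in> W \<Longrightarrow> \<bar>t\<bar> \<le> \<eta> \<Longrightarrow> x + t *\<^sub>R e \<in> V" and "real N \<le> S * \<eta>"
    and G0: "Lp_le p V G Y" and GN: "Lp_le p V ((dir_deriv e ^^ N) G) (Y * S ^ N)" and "i \<le> N"
  shows "Lp_le p W ((dir_deriv e ^^ i) G) (8 ^ N * Y * S ^ i)"
proof -
  define v where "v = (1 / S) *\<^sub>R e"
  have "x + t *\<^sub>R v \<in> V" if "x \<in> W" "\<bar>t\<bar> \<le> real N" for x t
  proof -
    have "\<bar>t / S\<bar> \<le> \<eta>" using that(2) assms(8) S by (simp add: field_simps)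
    from rng[OF that(1) this] show ?thesis by (simp add: v_def)
  qed
  note rng' = this
  have "0 \<le> \<eta>"
    using assms(8) S by (metis of_nat_0_le_iff order_trans zero_le_mult_iff not_le order_less_imp_le)
  then have WV: "W \<subseteq> V" using rng[of _ 0] by auto
  have "Lp_le p V (\<lambda>x. (1 / S) ^ N *\<^sub>R (dir_deriv e ^^ N) G x) (\<bar>(1 / S) ^ N\<bar> * (Y * S ^ N))"
    using assms(1) Y S
    by (intro Lp_le_scaleR p GN smooth_on_imp_continuous_on smooth_on_iterated_dir_deriv sm) auto
  then have "Lp_le p V ((dir_deriv v ^^ N) G) Y"
    by (rule Lp_le_mono)
       (use Y S in \<open>auto simp: v_def iterated_dir_deriv_scaleR[OF assms(1) sm] power_divide\<close>)
  from Lp_le_idiff_iterated_deriv[OF assms(1,2) p Y sm rng' G0 this, of i 0] \<open>i \<le> N\<close>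
  have "Lp_le p W ((dir_deriv v ^^ i) G) (2 ^ i * 4 ^ N * Y)" by simp
  then have "Lp_le p W (\<lambda>x. S ^ i *\<^sub>R (dir_deriv v ^^ i) G x) (\<bar>S ^ i\<bar> * (2 ^ i * 4 ^ N * Y))"
    using assms(2) Y
    by (intro Lp_le_scaleR p smooth_on_imp_continuous_on smooth_on_iterated_dir_deriv
        smooth_on_subset[OF sm WV]) auto
  then show ?thesis
  proof (rule Lp_le_mono)
    fix x assume "x \<in> W"
    then have "x \<in> V" using WV by auto
    then show "norm ((dir_deriv e ^^ i) G x) \<le> norm (S ^ i *\<^sub>R (dir_deriv v ^^ i) G x)"
      using S by (simp add: v_def iterated_dir_deriv_scaleR[OF assms(1) sm] power_divide)
  next
    have "2 ^ i * 4 ^ N \<le> (2 ^ N * 4 ^ N :: real)"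
      using \<open>i \<le> N\<close> by (intro mult_right_mono power_increasing) auto
    also have "\<dots> = 8 ^ N" by (simp flip: power_mult_distrib)
    finally have "S ^ i * Y * (2 ^ i * 4 ^ N) \<le> S ^ i * Y * 8 ^ N"
      using S Y by (intro mult_left_mono) auto
    then show "\<bar>S ^ i\<bar> * (2 ^ i * 4 ^ N * Y) \<le> 8 ^ N * Y * S ^ i"
      using S by (simp add: mult_ac)
  qed (use S Y in auto)
qed

text \<open>
  The local inequality treats a pure derivative \<open>\<partial>\<^sub>d\<^sup>i\<close> at
  the price of a factor \<open>8\<^sup>L\<close> and of one enlargement of the domain. A word
  that consists of few blocks of equal letters, in front of a word of order \<open>k\<close>,
  therefore costs as many factors and enlargements as it has blocks.
\<close>
lemma Lp_le_block_word:
  fixes f :: "real^'n::finite \<Rightarrow> 'b::banach" and W :: "nat \<Rightarrow> (real^'n) set"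
  assumes sm: "smooth_on U f" and p: "1 \<le> p" and C: "0 < C" and S: "0 < S"
    and W: "\<And>s. open (W s)" and WU: "\<And>s. s \<le> n \<Longrightarrow> W s \<subseteq> U"
    and rng: "\<And>s x t d. x \<in> W s \<Longrightarrow> \<bar>t\<bar> \<le> \<eta> \<Longrightarrow> x + t *\<^sub>R axis d 1 \<in> W (Suc s)"
    and LS: "real L \<le> S * \<eta>" and \<eta>: "0 \<le> \<eta>"
    and k: "\<And>s. s \<le> n \<Longrightarrow> derivs_le p (W s) f k (C * S ^ k)"
    and L: "\<And>s. s \<le> n \<Longrightarrow> derivs_le p (W s) f L (C * S ^ L)"
    and w0: "length w0 = k"
  shows "length (concat (map (\<lambda>(d, i). replicate i d) ps) @ w0) \<le> L \<Longrightarrow> length ps + s \<le> n \<Longrightarrow>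
    Lp_le p (W s) (foldr partial_deriv (concat (map (\<lambda>(d, i). replicate i d) ps) @ w0) f)
      (C * 8 ^ (L * length ps) * S ^ length (concat (map (\<lambda>(d, i). replicate i d) ps) @ w0))"
proof (induction ps arbitrary: s)
  case Nil
  then show ?case using k[of s] w0 by (simp add: derivs_le_def)
next
  case (Cons di ps)
  obtain d i where di: "di = (d, i)" by (cases di)
  define w where "w = concat (map (\<lambda>(d, i). replicate i d) ps) @ w0"
  define G where "G = foldr partial_deriv w f"
  define Y where "Y = C * 8 ^ (L * length ps) * S ^ length w"
  define N where "N = L - length w"
  have len: "i + length w \<le> L" using Cons.prems(1) by (simp add: di w_def)
  then have N: "L = N + length w" "i \<le> N" "N \<le> L" by (auto simp: N_def)
  have s: "Suc s \<le> n" using Cons.prems(2) by simp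
  have Y: "0 < Y" using C S by (simp add: Y_def)
  have G: "smooth_on (W (Suc s)) G"
    unfolding G_def by (rule smooth_on_foldr_partial_deriv[OF smooth_on_subset[OF sm WU[OF s]]])
  have G0: "Lp_le p (W (Suc s)) G Y"
    using Cons.IH[of "Suc s"] len Cons.prems(2) by (simp add: w_def G_def Y_def)
  have "length (replicate N d @ w) = L" using N(1) by simp
  from L[OF s, unfolded derivs_le_def, rule_format, OF this]
  have "Lp_le p (W (Suc s)) ((dir_deriv (axis d 1) ^^ N) G) (C * S ^ L)"
    by (simp only: foldr_partial_deriv_replicate G_def)
  then have GN: "Lp_le p (W (Suc s)) ((dir_deriv (axis d 1) ^^ N) G) (Y * S ^ N)"
  proof (rule Lp_le_mono)
    have "C * S ^ L * 1 \<le> C * S ^ L * 8 ^ (L * length ps)"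
      using C S by (intro mult_left_mono) auto
    then show "C * S ^ L \<le> Y * S ^ N" by (simp add: Y_def N(1) power_add mult_ac)
  qed (use C S in auto)
  have "real N \<le> S * \<eta>" using LS N(3) by linarith
  from Lp_le_iterated_dir_deriv_local[OF W W p Y S G rng this G0 GN N(2)]
  have "Lp_le p (W s) ((dir_deriv (axis d 1) ^^ i) G) (8 ^ N * Y * S ^ i)" by simp
  then have "Lp_le p (W s) ((dir_deriv (axis d 1) ^^ i) G)
      (C * 8 ^ (L * length (di # ps)) * S ^ (i + length w))"
  proof (rule Lp_le_mono)
    have "(8::real) ^ N \<le> 8 ^ L" using N by (intro power_increasing) auto
    then have "8 ^ N * (Y * S ^ i) \<le> 8 ^ L * (Y * S ^ i)" using Y S by (intro mult_right_mono) auto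
    then show "8 ^ N * Y * S ^ i \<le> C * 8 ^ (L * length (di # ps)) * S ^ (i + length w)"
      by (simp add: Y_def power_add mult_ac)
  qed (use Y S in auto)
  then show ?case
    by (simp add: di w_def G_def foldr_partial_deriv_replicate partial_deriv_eq_dir_deriv[of d])
qed

text \<open>
  An initial segment of a word in blocks has no more blocks than the word. So if the last
  \<open>k\<close> letters of the word of a multiindex are set aside, the rest still has one
  (possibly empty) block per coordinate.
\<close>
lemma take_concat_replicate:
  "\<exists>ps'. length ps' = length ps \<and>
     take r (concat (map (\<lambda>(d, i). replicate i d) ps)) = concat (map (\<lambda>(d, i). replicate i d) ps')"
proof (induction ps arbitrary: r)
  case (Cons di ps)
  obtain d i where di: "di = (d, i)" by (cases di)
  obtain ps' where "length ps' = length ps"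
     "take (r - i) (concat (map (\<lambda>(d, i). replicate i d) ps)) = concat (map (\<lambda>(d, i). replicate i d) ps')"
    using Cons.IH by blast
  then show ?case by (intro exI[of _ "(d, min r i) # ps'"]) (simp add: di min.commute)
qed simp

lemma Lp_le_mi_deriv_local:
  fixes f :: "real^'n::finite \<Rightarrow> 'b::banach" and W :: "nat \<Rightarrow> (real^'n) set"
  assumes sm: "smooth_on U f" and p: "1 \<le> p" and C: "0 < C" and S: "0 < S"
    and W: "\<And>s. open (W s)" and WU: "\<And>s. s \<le> CARD('n) \<Longrightarrow> W s \<subseteq> U"
    and rng: "\<And>s x t d. x \<in> W s \<Longrightarrow> \<bar>t\<bar> \<le> \<eta> \<Longrightarrow> x + t *\<^sub>R axis d 1 \<in> W (Suc s)"
    and LS: "real L \<le> S * \<eta>" and \<eta>: "0 \<le> \<eta>"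
    and k: "\<And>s. s \<le> CARD('n) \<Longrightarrow> derivs_le p (W s) f k (C * S ^ k)"
    and L: "\<And>s. s \<le> CARD('n) \<Longrightarrow> derivs_le p (W s) f L (C * S ^ L)"
    and \<alpha>: "k \<le> mi_order \<alpha>" "mi_order \<alpha> \<le> L"
  shows "Lp_le p (W 0) (mi_deriv \<alpha> f) (C * 8 ^ (L * CARD('n)) * S ^ mi_order \<alpha>)"
proof -
  define r where "r = mi_order \<alpha> - k"
  have "mi_word \<alpha> = concat (map (\<lambda>(d, i). replicate i d) (map (\<lambda>i. (i, \<alpha> $ i)) coordinates))"
    by (simp add: mi_word_def o_def)
  then obtain ps where ps: "length ps = CARD('n)"
      "take r (mi_word \<alpha>) = concat (map (\<lambda>(d, i). replicate i d) ps)"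
    using take_concat_replicate[of "map (\<lambda>i. (i, \<alpha> $ i)) coordinates" r] by (auto simp: length_coordinates)
  have split: "concat (map (\<lambda>(d, i). replicate i d) ps) @ drop r (mi_word \<alpha>) = mi_word \<alpha>"
    unfolding ps(2)[symmetric] by simp
  have "length (drop r (mi_word \<alpha>)) = k" using \<alpha> by (simp add: r_def length_mi_word)
  from Lp_le_block_word[where W = W and n = "CARD('n)" and ps = ps and s = 0,
      OF sm p C S W WU rng LS \<eta> k L this] \<alpha>(2)
  show ?thesis unfolding split by (simp add: ps length_mi_word mi_deriv_eq_foldr)
qed

section \<open>Weight sequences and base sequences\<close>

lemma weight_root_pos: "weight_sequence M \<Longrightarrow> 0 < weight_root M k"
  by (simp add: weight_sequence_def weight_root_def less_imp_neq[symmetric])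

text \<open>
  Since the quotients increase, \<open>M k \<le> \<mu>\<^sup>k\<close> for \<open>\<mu> = M (k
  + 1) / M k\<close>; multiplying by \<open>(M k)\<^sup>k\<close> gives \<open>(M
  k)\<^sup>k\<^sup>+\<^sup>1 \<le> (M (k + 1))\<^sup>k\<close>.
\<close>
lemma weight_root_mono:
  assumes "weight_sequence M" "k \<le> l"
  shows "weight_root M k \<le> weight_root M l"
proof -
  have pos: "M k > 0" and M0: "M 0 = 1" and M1: "1 \<le> M 1" for k
    using assms(1) by (auto simp: weight_sequence_def)
  have q: "M (Suc k) = weight_quotient M (Suc k) * M k" for k
    using pos[of k] by (simp add: weight_quotient_def)
  have qpos: "weight_quotient M k > 0" for k
    using pos by (simp add: weight_quotient_def)
  have qmono: "weight_quotient M k \<le> weight_quotient M (Suc k)" if "k \<ge> 1" for k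
    using assms(1) that by (simp add: weight_sequence_def)
  have le: "M k \<le> weight_quotient M (Suc k) ^ k" for k
  proof (induction k)
    case 0
    then show ?case by (simp add: M0)
  next
    case (Suc k)
    have "M (Suc k) \<le> weight_quotient M (Suc k) * weight_quotient M (Suc k) ^ k"
      unfolding q[of k] using qpos[of "Suc k"] Suc by (intro mult_left_mono) auto
    also have "\<dots> = weight_quotient M (Suc k) ^ Suc k" by simp
    also have "\<dots> \<le> weight_quotient M (Suc (Suc k)) ^ Suc k"
      using qpos[of "Suc k"] qmono[of "Suc k"] by (intro power_mono) auto
    finally show ?case .
  qed
  have step: "weight_root M k \<le> weight_root M (Suc k)" for k
  proof (cases "k = 0")
    case True
    then show ?thesis using M1 pos[of 1] by (simp add: weight_root_def)
  next
    case False
    have r: "weight_root M j ^ j = M j" if "j > 0" for j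
      using that pos[of j] by (simp add: weight_root_def powr_powr flip: powr_realpow)
    have "weight_root M k ^ (k * Suc k) = (weight_root M k ^ k) ^ Suc k" by (rule power_mult)
    also have "\<dots> = M k ^ k * M k" using r[of k] False by simp
    also have "\<dots> \<le> M k ^ k * weight_quotient M (Suc k) ^ k"
      using le[of k] pos[of k] by (intro mult_left_mono) auto
    also have "\<dots> = M (Suc k) ^ k" unfolding q[of k] by (simp add: power_mult_distrib mult.commute)
    also have "\<dots> = weight_root M (Suc k) ^ (k * Suc k)"
      unfolding r[OF zero_less_Suc, symmetric] power_mult[symmetric] by (simp add: mult.commute)
    finally show ?thesis
      using False weight_root_pos[OF assms(1), of "Suc k"]
      by (subst (asm) power_mono_iff) (auto simp: less_imp_le weight_root_pos[OF assms(1)])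
  qed
  show ?thesis using assms(2) by (rule lift_Suc_mono_le[of "weight_root M", OF step])
qed

lemma base_sequence_between:
  assumes "base_sequence k"
  obtains j where "k j \<le> q" "q < k (Suc j)"
proof -
  have k0: "k 0 = 0" and sm: "strict_mono k" using assms by (auto simp: base_sequence_def)
  define j where "j = (LEAST j. q < k (Suc j))"
  have "q < k (Suc q)" using strict_mono_imp_increasing[OF sm, of "Suc q"] by simp
  then have 1: "q < k (Suc j)" unfolding j_def by (rule LeastI)
  have "k j \<le> q"
  proof (cases j)
    case (Suc i)
    then have "\<not> q < k (Suc i)" unfolding j_def by (intro not_less_Least) simp
    then show ?thesis using Suc by simp
  qed (simp add: k0)
  with 1 that show thesis by blast
qed

lemma finite_mi_order: "finite {\<alpha> :: nat^'n::finite. mi_order \<alpha> = q}"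
proof (rule finite_imageD[of vec_nth])
  have "vec_nth ` {\<alpha> :: nat^'n. mi_order \<alpha> = q} \<subseteq> UNIV \<rightarrow>\<^sub>E {..q}"
    by (auto simp: mi_order_def PiE_def intro: member_le_sum)
  then show "finite (vec_nth ` {\<alpha> :: nat^'n. mi_order \<alpha> = q})"
    by (rule finite_subset) (auto intro: finite_PiE)
qed (auto simp: inj_on_def vec_nth_inject)

lemma ex_mi_order: "\<exists>\<alpha> :: nat^'n::finite. mi_order \<alpha> = q"
  by (rule exI[of _ "\<chi> i. if i = undefined then q else 0"]) (simp add: mi_order_def)

lemma Max_mi_order_le_iff:
  "Max {Lp_norm p \<Omega> (mi_deriv \<alpha> f) | \<alpha>. mi_order \<alpha> = q} \<le> X \<longleftrightarrow>
   (\<forall>\<alpha>. mi_order \<alpha> = q \<longrightarrow> Lp_norm p \<Omega> (mi_deriv \<alpha> f) \<le> X)"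
  (is "Max ?A \<le> X \<longleftrightarrow> _")
proof -
  have "?A = (\<lambda>\<alpha>. Lp_norm p \<Omega> (mi_deriv \<alpha> f)) ` {\<alpha>. mi_order \<alpha> = q}" by auto
  then have "finite ?A" "?A \<noteq> {}" using finite_mi_order[of q] ex_mi_order[of q] by auto
  then show ?thesis by (subst Max_le_iff) auto
qed

lemma dc_bound_mono: "dc_bound t P \<Longrightarrow> (\<And>C \<rho>. P C \<rho> \<Longrightarrow> Q C \<rho>) \<Longrightarrow> dc_bound t Q"
  by (cases t) (simp; blast)+

lemma B_class_subset: "B_class t M p \<subseteq> B_class_on K t M p"
  by (auto simp: B_class_on_def elim: dc_bound_mono)

lemma E_class_subset: "E_class t M p U \<subseteq> E_class_on K t M p U"
  by (auto simp: E_class_on_def elim!: dc_bound_mono)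

text \<open>
  Let \<open>k j \<le> q < k (j + 1)\<close>. With \<open>S = H \<rho> m\<close>, where
  \<open>m\<close> is the root of order \<open>k j\<close>, the assumed bounds at both
  endpoints take the form \<open>C S\<^sup>l\<close> that interpolation needs, and
  \<open>S\<close> is at most \<open>H \<rho>\<close> times the root of order
  \<open>q\<close>.
\<close>
lemma global_bound_all_orders:
  fixes f :: "real^'n::finite \<Rightarrow> 'b::banach"
  assumes p: "1 \<le> p" and k: "base_sequence k" and M: "weight_sequence M"
    and H: "1 \<le> H" "\<And>j. weight_root M (k (Suc j)) \<le> H * weight_root M (k j)"
    and sm: "smooth_on UNIV f" and C: "0 < C" and \<rho>: "0 < \<rho>"
    and bd: "\<And>\<alpha>. mi_order \<alpha> \<in> range k \<Longrightarrow>
      Lp_norm p UNIV (mi_deriv \<alpha> f) \<le> ennreal (C * (\<rho> * weight_root M (mi_order \<alpha>)) ^ mi_order \<alpha>)"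
  shows "Lp_norm p UNIV (mi_deriv \<alpha> f)
      \<le> ennreal (C * ((20 * H * \<rho>) * weight_root M (mi_order \<alpha>)) ^ mi_order \<alpha>)"
proof -
  define q where "q = mi_order \<alpha>"
  obtain j where j: "k j \<le> q" "q < k (Suc j)" using base_sequence_between[OF k] .
  note m = weight_root_pos[OF M]
  define S where "S = H * \<rho> * weight_root M (k j)"
  have S: "0 < S" using H(1) \<rho> m[of "k j"] by (simp add: S_def)
  have ord: "derivs_le p UNIV f (k i) (C * S ^ k i)" if "\<rho> * weight_root M (k i) \<le> S" for i
  proof (rule derivs_le_mono[OF _ subset_UNIV])
    have nn: "0 \<le> \<rho> * weight_root M (k i)" using \<rho> m[of "k i"] by simp
    then show "derivs_le p UNIV f (k i) (C * (\<rho> * weight_root M (k i)) ^ k i)"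
      using C by (subst derivs_le_iff[OF open_UNIV sm p]) (use bd in \<open>auto, metis rangeI\<close>)
    show "C * (\<rho> * weight_root M (k i)) ^ k i \<le> C * S ^ k i"
      using that nn C by (intro mult_left_mono power_mono) auto
    show "0 \<le> C * (\<rho> * weight_root M (k i)) ^ k i" using nn C by simp
  qed
  have "derivs_le p UNIV f (k j) (C * S ^ k j)"
    using H(1) \<rho> m[of "k j"] by (intro ord) (simp add: S_def)
  moreover have "derivs_le p UNIV f (k (Suc j)) (C * S ^ k (Suc j))"
    using H(2)[of j] \<rho> by (intro ord) (simp add: S_def mult_ac)
  ultimately have "derivs_le p UNIV f (k j + (q - k j)) (C * 20 ^ (q - k j) * S ^ (k j + (q - k j)))"
    using j by (intro derivs_le_interpolate[OF sm p C S, where L = "k (Suc j)"]) auto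
  then have "derivs_le p UNIV f q (C * 20 ^ (q - k j) * S ^ q)" using j by simp
  moreover have "C * 20 ^ (q - k j) * S ^ q \<le> C * ((20 * H * \<rho>) * weight_root M q) ^ q"
  proof -
    have "S \<le> H * \<rho> * weight_root M q"
      unfolding S_def using H(1) \<rho> j weight_root_mono[OF M] by (intro mult_left_mono) auto
    then have "20 ^ (q - k j) * S ^ q \<le> 20 ^ q * (H * \<rho> * weight_root M q) ^ q"
      using S by (intro mult_mono power_increasing power_mono) auto
    also have "\<dots> = ((20 * H * \<rho>) * weight_root M q) ^ q" by (simp add: power_mult_distrib)
    finally show ?thesis using C by (simp add: mult.assoc)
  qed
  ultimately have "derivs_le p UNIV f q (C * ((20 * H * \<rho>) * weight_root M q) ^ q)"
    using C S by (auto intro: derivs_le_mono)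
  moreover have "0 \<le> C * ((20 * H * \<rho>) * weight_root M q) ^ q"
    using C H(1) \<rho> m[of q] by simp
  ultimately show ?thesis
    using derivs_le_iff[OF open_UNIV sm p] by (simp add: q_def)
qed

text \<open>
  The sets \<open>W s\<close> are the open neighbourhoods of \<open>\<Omega>\<close> of radius
  \<open>(s + 1) \<eta>\<close>.
\<close>
lemma relatively_compact_neighbourhoods:
  fixes \<Omega> :: "(real^'n::finite) set"
  assumes "open U" "compact (closure \<Omega>)" "closure \<Omega> \<subseteq> U"
  obtains \<eta> :: real and W :: "nat \<Rightarrow> (real^'n) set"
  where "0 < \<eta>" "\<And>s. open (W s)" "\<Omega> \<subseteq> W 0" "\<And>r s. r \<le> s \<Longrightarrow> W r \<subseteq> W s"
    "\<And>s x t d. x \<in> W s \<Longrightarrow> \<bar>t\<bar> \<le> \<eta> \<Longrightarrow> x + t *\<^sub>R axis d 1 \<in> W (Suc s)"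
    "compact (closure (W n))" "closure (W n) \<subseteq> U"
proof -
  obtain e where e: "e > 0" "(\<Union>x\<in>closure \<Omega>. cball x e) \<subseteq> U"
    using compact_subset_open_imp_cball_epsilon_subset[OF assms(2,1,3)] by blast
  define \<eta> where "\<eta> = e / (real n + 1)"
  have \<eta>: "\<eta> > 0" using e by (simp add: \<eta>_def)
  define W where "W s = (\<Union>x\<in>\<Omega>. ball x ((real s + 1) * \<eta>))" for s
  have K: "compact (\<Union>x\<in>closure \<Omega>. cball x e)"
  proof -
    have "(\<Union>x\<in>closure \<Omega>. cball x e) = {x + y |x y. x \<in> closure \<Omega> \<and> y \<in> cball 0 e}"
    proof safe
      fix z x assume "x \<in> closure \<Omega>" "z \<in> cball x e"
      then show "\<exists>x y. z = x + y \<and> x \<in> closure \<Omega> \<and> y \<in> cball 0 e"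
        by (intro exI[of _ x] exI[of _ "z - x"]) (auto simp: dist_norm norm_minus_commute)
    next
      fix x y :: "real^'n" assume "x \<in> closure \<Omega>" "y \<in> cball 0 e"
      then show "x + y \<in> (\<Union>x\<in>closure \<Omega>. cball x e)"
        by (intro UN_I[of x]) (auto simp: dist_norm)
    qed
    then show ?thesis using compact_sums[OF assms(2) compact_cball[of 0 e]] by simp
  qed
  have "W n \<subseteq> (\<Union>x\<in>closure \<Omega>. cball x e)"
  proof
    fix z assume "z \<in> W n"
    then obtain x where x: "x \<in> \<Omega>" "dist x z < (real n + 1) * \<eta>" by (auto simp: W_def)
    have "(real n + 1) * \<eta> = e" by (simp add: \<eta>_def add_nonneg_eq_0_iff)
    then show "z \<in> (\<Union>x\<in>closure \<Omega>. cball x e)"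
      using x closure_subset[of \<Omega>] by (intro UN_I[of x]) auto
  qed
  then have cl: "closure (W n) \<subseteq> (\<Union>x\<in>closure \<Omega>. cball x e)"
    by (intro closure_minimal compact_imp_closed K)
  show thesis
  proof (rule that[of \<eta> W])
    show "compact (closure (W n))"
      using compact_Int_closed[OF K closed_closure, of "W n"] cl by (simp add: Int_absorb1)
    show "closure (W n) \<subseteq> U" using cl e(2) by blast
    show "\<Omega> \<subseteq> W 0" using \<eta> by (auto simp: W_def)
    show "open (W s)" for s by (auto simp: W_def)
    show "W r \<subseteq> W s" if "r \<le> s" for r s
    proof -
      have "(real r + 1) * \<eta> \<le> (real s + 1) * \<eta>" using that \<eta> by (intro mult_right_mono) auto
      then show ?thesis unfolding W_def by (intro UN_mono subset_ball) auto
    qed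
    show "x + t *\<^sub>R axis d 1 \<in> W (Suc s)" if "x \<in> W s" "\<bar>t\<bar> \<le> \<eta>" for s x t d
    proof -
      obtain y where y: "y \<in> \<Omega>" "dist y x < (real s + 1) * \<eta>" using \<open>x \<in> W s\<close> by (auto simp: W_def)
      have "dist y (x + t *\<^sub>R axis d 1) \<le> dist y x + dist x (x + t *\<^sub>R axis d 1)"
        by (rule dist_triangle)
      also have "dist x (x + t *\<^sub>R axis d 1) = \<bar>t\<bar>" by (simp add: dist_norm norm_axis_1)
      finally have "dist y (x + t *\<^sub>R axis d 1) < (real (Suc s) + 1) * \<eta>"
        using y that by (simp add: algebra_simps)
      then show ?thesis using y by (auto simp: W_def)
    qed
  qed (fact \<eta>)
qed

text \<open>
  As in the global case, but the local inequality moves points by a distance up to \<open>L /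
  S\<close> in each direction, where \<open>L\<close> is the upper order, and this distance
  has to be at most \<open>\<eta>\<close>. So \<open>S\<close> has to be at least \<open>L /
  \<eta>\<close>. Since \<open>L \<le> b q\<close>, the factors \<open>8\<^sup>L\<close> are
  exponential in \<open>q\<close>, and \<open>L / \<eta>\<close> is at most \<open>(b /
  \<eta>) (q / m)\<close> times the root \<open>m\<close> of order \<open>q\<close>. The ratio
  \<open>q / m\<close> is kept in the estimate, because the Roumieu case needs it bounded and
  the Beurling case needs it small.
\<close>
lemma local_bound_all_orders:
  fixes f :: "real^'n::finite \<Rightarrow> 'b::banach" and W :: "nat \<Rightarrow> (real^'n) set"
  assumes p: "1 \<le> p" and k: "base_sequence k" and M: "weight_sequence M"
    and H: "1 \<le> H" "\<And>j. weight_root M (k (Suc j)) \<le> H * weight_root M (k j)"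
    and b: "\<forall>j. \<forall>q\<ge>1. k j \<le> q \<longrightarrow> k (Suc j) \<le> b * q"
    and sm: "smooth_on U f" and C: "0 < C" and \<rho>: "0 < \<rho>" and \<eta>: "0 < \<eta>"
    and W: "\<And>s. open (W s)" "\<Omega> \<subseteq> W 0" "\<And>r s. r \<le> s \<Longrightarrow> W r \<subseteq> W s"
    and rng: "\<And>s x t d. x \<in> W s \<Longrightarrow> \<bar>t\<bar> \<le> \<eta> \<Longrightarrow> x + t *\<^sub>R axis d 1 \<in> W (Suc s)"
    and WU: "W CARD('n) \<subseteq> U" and \<Omega>: "open \<Omega>"
    and bd: "\<And>\<alpha>. mi_order \<alpha> \<in> range k \<Longrightarrow> Lp_norm p (W CARD('n)) (mi_deriv \<alpha> f)
        \<le> ennreal (C * (\<rho> * weight_root M (mi_order \<alpha>)) ^ mi_order \<alpha>)"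
  shows "Lp_norm p \<Omega> (mi_deriv \<alpha> f) \<le> ennreal (C * (8 ^ (b * CARD('n)) *
      (H * \<rho> + real b / \<eta> * (real (mi_order \<alpha>) / weight_root M (mi_order \<alpha>)))
        * weight_root M (mi_order \<alpha>)) ^ mi_order \<alpha>)"
proof -
  define q where "q = mi_order \<alpha>"
  let ?n = "CARD('n)"
  note m = weight_root_pos[OF M]
  have WU': "W s \<subseteq> U" if "s \<le> ?n" for s using W(3)[OF that] WU by blast
  have ord: "derivs_le p (W s) f (k i) (C * S ^ k i)"
    if "s \<le> ?n" "\<rho> * weight_root M (k i) \<le> S" for i s S
  proof (rule derivs_le_mono[OF _ W(3)[OF that(1)]])
    have nn: "0 \<le> \<rho> * weight_root M (k i)" using \<rho> m[of "k i"] by simp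
    then show "derivs_le p (W ?n) f (k i) (C * (\<rho> * weight_root M (k i)) ^ k i)"
      using C by (subst derivs_le_iff[OF W(1) smooth_on_subset[OF sm WU] p]) (use bd in \<open>auto, metis rangeI\<close>)
    show "C * (\<rho> * weight_root M (k i)) ^ k i \<le> C * S ^ k i"
      using that nn C by (intro mult_left_mono power_mono) auto
    show "0 \<le> C * (\<rho> * weight_root M (k i)) ^ k i" using nn C by simp
  qed
  define R where "R = C * (8 ^ (b * ?n) * (H * \<rho> + real b / \<eta> * (real q / weight_root M q)) * weight_root M q) ^ q"
  have R: "0 \<le> R" using C H(1) \<rho> \<eta> m[of q] by (auto simp: R_def)
  have "Lp_le p \<Omega> (mi_deriv \<alpha> f) R"
  proof (cases "q = 0")
    case True
    have "k 0 = 0" using k by (simp add: base_sequence_def)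
    then have "derivs_le p (W 0) f 0 C"
      using ord[of 0 0 "\<rho> * weight_root M (k 0)"] by simp
    then have "Lp_le p (W 0) (mi_deriv \<alpha> f) C"
      using True by (metis derivs_le_def mi_deriv_eq_foldr length_mi_word q_def)
    then show ?thesis using C W(2) by (auto simp: R_def True intro: Lp_le_mono)
  next
    case False
    obtain j where j: "k j \<le> q" "q < k (Suc j)" using base_sequence_between[OF k] .
    define L where "L = k (Suc j)"
    have L: "L \<le> b * q" unfolding L_def using b False j by auto
    define S where "S = H * \<rho> * weight_root M (k j) + real L / \<eta>"
    have S: "0 < S" using H(1) \<rho> \<eta> m[of "k j"] by (simp add: S_def add_pos_nonneg)
    have S1: "H * \<rho> * weight_root M (k j) \<le> S" using \<eta> by (simp add: S_def)
    have "\<rho> * weight_root M (k j) \<le> H * \<rho> * weight_root M (k j)"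
      using H(1) \<rho> m[of "k j"] by simp
    with S1 have Sj: "\<rho> * weight_root M (k j) \<le> S" by linarith
    have "\<rho> * weight_root M (k (Suc j)) \<le> H * \<rho> * weight_root M (k j)"
      using H(2)[of j] \<rho> by (simp add: mult_ac)
    with S1 have SL: "\<rho> * weight_root M (k (Suc j)) \<le> S" by linarith
    have "real L \<le> S * \<eta>"
      using H(1) \<rho> \<eta> m[of "k j"] by (simp add: S_def distrib_right)
    then have "Lp_le p (W 0) (mi_deriv \<alpha> f) (C * 8 ^ (L * ?n) * S ^ q)"
      unfolding q_def using j ord[OF _ Sj] ord[OF _ SL] \<eta>
      by (intro Lp_le_mi_deriv_local[where W = W, OF sm p C S W(1) WU' rng]) (auto simp: L_def q_def)
    then show ?thesis
    proof (rule Lp_le_mono[OF _ W(2)])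
      have "real L \<le> real b * real q" using L by (simp flip: of_nat_mult)
      then have "real L / \<eta> \<le> real b * real q / \<eta>" using \<eta> by (intro divide_right_mono) auto
      moreover have "H * \<rho> * weight_root M (k j) \<le> H * \<rho> * weight_root M q"
        using H(1) \<rho> j weight_root_mono[OF M] by (intro mult_left_mono) auto
      ultimately have "S \<le> (H * \<rho> + real b / \<eta> * (real q / weight_root M q)) * weight_root M q"
        using m[of q] by (simp add: S_def distrib_right)
      then have "8 ^ (L * ?n) * S ^ q
          \<le> 8 ^ (b * q * ?n) * ((H * \<rho> + real b / \<eta> * (real q / weight_root M q)) * weight_root M q) ^ q"
        using S L by (intro mult_mono power_increasing power_mono mult_right_mono) auto
      also have "\<dots> = (8 ^ (b * ?n) * (H * \<rho> + real b / \<eta> * (real q / weight_root M q)) * weight_root M q) ^ q"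
        by (simp add: power_mult_distrib mult_ac flip: power_mult)
      finally show "C * 8 ^ (L * ?n) * S ^ q \<le> R"
        using C by (simp add: R_def mult.assoc)
    qed (use C S in auto)
  qed
  moreover have "continuous_on \<Omega> (mi_deriv \<alpha> f)"
    unfolding mi_deriv_eq_foldr using W(2) W(3)[of 0 ?n] WU
    by (intro smooth_on_imp_continuous_on smooth_on_foldr_partial_deriv smooth_on_subset[OF sm]) auto
  ultimately have "Lp_norm p \<Omega> (mi_deriv \<alpha> f) \<le> ennreal R"
    by (subst Lp_norm_le_iff[OF \<Omega> _ p R])
  then show ?thesis by (simp only: R_def q_def)
qed

section \<open>Equality of the classes\<close>

lemma B_class_on_base_sequence:
  assumes p: "1 \<le> p" and k: "base_sequence k" and M: "weight_sequence M"
    and H: "1 \<le> H" "\<And>j. weight_root M (k (Suc j)) \<le> H * weight_root M (k j)"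
  shows "(B_class_on (range k) t M p :: (real^'n::finite \<Rightarrow> complex) set) = B_class t M p"
proof (rule antisym[OF _ B_class_subset], rule subsetI)
  fix f :: "real^'n \<Rightarrow> complex" assume f: "f \<in> B_class_on (range k) t M p"
  let ?P = "\<lambda>K C \<rho>. \<forall>\<alpha>. mi_order \<alpha> \<in> K \<longrightarrow> Lp_norm p UNIV (mi_deriv \<alpha> f)
    \<le> ennreal (C * (\<rho> * weight_root M (mi_order \<alpha>)) ^ mi_order \<alpha>)"
  have sm: "smooth_on UNIV f" and bd: "dc_bound t (?P (range k))"
    using f by (auto simp: B_class_on_def)
  have step: "?P UNIV C (20 * H * \<rho>)" if "?P (range k) C \<rho>" "0 < C" "0 < \<rho>" for C \<rho>
    using global_bound_all_orders[OF p k M H sm that(2,3)] that(1) by blast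
  have "dc_bound t (?P UNIV)"
  proof (cases t)
    case Roumieu
    obtain C \<rho> where C: "C > 0" "\<rho> > 0" "?P (range k) C \<rho>"
      using bd[unfolded Roumieu dc_bound.simps] by blast
    have "20 * H * \<rho> > 0" using H(1) C(2) by simp
    then show ?thesis
      unfolding Roumieu dc_bound.simps using step[OF C(3,1,2)] C(1) by blast
  next
    case Beurling
    have "\<exists>C>0. ?P UNIV C \<rho>" if "\<rho> > 0" for \<rho>
    proof -
      have \<rho>: "\<rho> / (20 * H) > 0" using H(1) that by simp
      then obtain C where C: "C > 0" "?P (range k) C (\<rho> / (20 * H))"
        using bd[unfolded Beurling dc_bound.simps] by blast
      have "20 * H * (\<rho> / (20 * H)) = \<rho>" using H(1) by simp
      with step[OF C(2,1) \<rho>] C(1) show ?thesis by metis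
    qed
    then show ?thesis unfolding Beurling dc_bound.simps by blast
  qed
  then show "f \<in> B_class t M p" using sm by (simp add: B_class_on_def)
qed

lemma special_base_sequence_step:
  assumes "special_base_sequence k"
  obtains b :: nat where "\<forall>j. \<forall>q\<ge>1. k j \<le> q \<longrightarrow> k (Suc j) \<le> b * q"
proof -
  have sm: "strict_mono k" and k0: "k 0 = 0"
    and bdd: "bdd_above ((\<lambda>j. real (k (Suc j)) / real (k j)) ` {1..})"
    using assms by (auto simp: special_base_sequence_def base_sequence_def)
  obtain c where c: "\<And>j. 1 \<le> j \<Longrightarrow> real (k (Suc j)) / real (k j) \<le> c"
    using bdd unfolding bdd_above_def by auto
  define b where "b = max (k 1) (nat \<lceil>c\<rceil>)"
  have "k (Suc j) \<le> b * q" if "1 \<le> q" "k j \<le> q" for j q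
  proof (cases "j = 0")
    case True
    have "k 1 * 1 \<le> b * q" using that by (intro mult_mono) (auto simp: b_def)
    then show ?thesis using True by simp
  next
    case False
    then have "0 < k j" using strict_monoD[OF sm, of 0 j] k0 by simp
    then have "real (k (Suc j)) \<le> c * real (k j)" using c[of j] False by (simp add: field_simps)
    also have "\<dots> \<le> real b * real q"
      using that by (intro mult_mono) (auto simp: b_def, linarith)
    finally show ?thesis by (simp flip: of_nat_mult)
  qed
  then show thesis by (intro that) blast
qed

text \<open>
  The local estimate in terms of the defining quantifiers. The constants \<open>E\<close> and
  \<open>\<beta>\<close> do not depend on \<open>C\<close> and \<open>\<rho>\<close>; in the
  Beurling case \<open>\<rho>\<close> is chosen after them.
\<close>
lemma E_class_on_local_bound:
  fixes f :: "real^'n::finite \<Rightarrow> complex"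
  assumes p: "1 \<le> p" and k: "base_sequence k" and M: "weight_sequence M"
    and H: "1 \<le> H" "\<And>j. weight_root M (k (Suc j)) \<le> H * weight_root M (k j)"
    and b: "\<forall>j. \<forall>q\<ge>1. k j \<le> q \<longrightarrow> k (Suc j) \<le> b * q"
    and U: "open U" and f: "f \<in> E_class_on (range k) t M p U"
    and \<Omega>: "open \<Omega>" "compact (closure \<Omega>)" "closure \<Omega> \<subseteq> U"
  obtains E \<beta> where "0 < E" "0 \<le> \<beta>" "dc_bound t (\<lambda>C \<rho>. 0 < C \<and> 0 < \<rho> \<longrightarrow> (\<forall>\<alpha>. Lp_norm p \<Omega> (mi_deriv \<alpha> f)
      \<le> ennreal (C * (E * (H * \<rho> + \<beta> * (real (mi_order \<alpha>) / weight_root M (mi_order \<alpha>)))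
          * weight_root M (mi_order \<alpha>)) ^ mi_order \<alpha>)))"
proof -
  have sm: "smooth_on U f" using f by (simp add: E_class_on_def)
  obtain \<eta> :: real and W :: "nat \<Rightarrow> (real^'n) set" where W: "0 < \<eta>" "\<And>s. open (W s)" "\<Omega> \<subseteq> W 0"
      "\<And>r s. r \<le> s \<Longrightarrow> W r \<subseteq> W s"
      "\<And>s x t d. x \<in> W s \<Longrightarrow> \<bar>t\<bar> \<le> \<eta> \<Longrightarrow> x + t *\<^sub>R axis d 1 \<in> W (Suc s)"
      "compact (closure (W CARD('n)))" "closure (W CARD('n)) \<subseteq> U"
    using relatively_compact_neighbourhoods[OF U \<Omega>(2,3), where n = "CARD('n)"] by metis
  have WU: "W CARD('n) \<subseteq> U" using W(7) closure_subset by blast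
  have "dc_bound t (\<lambda>C \<rho>. \<forall>q\<in>range k. Max {Lp_norm p (W CARD('n)) (mi_deriv \<alpha> f) | \<alpha>. mi_order \<alpha> = q}
                \<le> ennreal (C * (\<rho> * weight_root M q) ^ q))"
    using f W(2,6,7) by (simp add: E_class_on_def)
  then have "dc_bound t (\<lambda>C \<rho>. 0 < C \<and> 0 < \<rho> \<longrightarrow> (\<forall>\<alpha>. Lp_norm p \<Omega> (mi_deriv \<alpha> f)
      \<le> ennreal (C * (8 ^ (b * CARD('n)) *
          (H * \<rho> + real b / \<eta> * (real (mi_order \<alpha>) / weight_root M (mi_order \<alpha>)))
          * weight_root M (mi_order \<alpha>)) ^ mi_order \<alpha>)))"
  proof (rule dc_bound_mono, intro impI allI)
    fix C \<rho> :: real and \<alpha> :: "nat^'n"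
    assume "\<forall>q\<in>range k. Max {Lp_norm p (W CARD('n)) (mi_deriv \<alpha> f) | \<alpha>. mi_order \<alpha> = q}
                \<le> ennreal (C * (\<rho> * weight_root M q) ^ q)" and pos: "0 < C \<and> 0 < \<rho>"
    then have "Lp_norm p (W CARD('n)) (mi_deriv \<alpha> f)
        \<le> ennreal (C * (\<rho> * weight_root M (mi_order \<alpha>)) ^ mi_order \<alpha>)" if "mi_order \<alpha> \<in> range k" for \<alpha>
      using that unfolding Max_mi_order_le_iff by blast
    with pos show "Lp_norm p \<Omega> (mi_deriv \<alpha> f) \<le> ennreal (C * (8 ^ (b * CARD('n)) *
          (H * \<rho> + real b / \<eta> * (real (mi_order \<alpha>) / weight_root M (mi_order \<alpha>)))
          * weight_root M (mi_order \<alpha>)) ^ mi_order \<alpha>)"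
      by (intro local_bound_all_orders[OF p k M H b sm _ _ W(1-5) WU \<Omega>(1)]) auto
  qed
  then show thesis by (rule that[rotated 2]) (use W(1) in auto)
qed

lemma E_class_on_Roumieu:
  assumes p: "1 \<le> p" and k: "base_sequence k" and M: "weight_sequence M"
    and H: "1 \<le> H" "\<And>j. weight_root M (k (Suc j)) \<le> H * weight_root M (k j)"
    and b: "\<forall>j. \<forall>q\<ge>1. k j \<le> q \<longrightarrow> k (Suc j) \<le> b * q"
    and U: "open U" and D: "\<And>q. real q / weight_root M q \<le> D"
  shows "(E_class_on (range k) Roumieu M p U :: (real^'n::finite \<Rightarrow> complex) set) = E_class Roumieu M p U"
proof (rule antisym[OF _ E_class_subset], rule subsetI)
  fix f :: "real^'n \<Rightarrow> complex" assume f: "f \<in> E_class_on (range k) Roumieu M p U"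
  note m = weight_root_pos[OF M]
  have "\<exists>C>0. \<exists>\<rho>>0. \<forall>q\<in>UNIV. Max {Lp_norm p \<Omega> (mi_deriv \<alpha> f) | \<alpha>. mi_order \<alpha> = q}
      \<le> ennreal (C * (\<rho> * weight_root M q) ^ q)"
    if \<Omega>: "open \<Omega>" "compact (closure \<Omega>)" "closure \<Omega> \<subseteq> U" for \<Omega>
  proof -
    obtain E \<beta> where E\<beta>: "0 < E" "0 \<le> \<beta>"
      and dc: "dc_bound Roumieu (\<lambda>C \<rho>. 0 < C \<and> 0 < \<rho> \<longrightarrow> (\<forall>\<alpha>. Lp_norm p \<Omega> (mi_deriv \<alpha> f)
        \<le> ennreal (C * (E * (H * \<rho> + \<beta> * (real (mi_order \<alpha>) / weight_root M (mi_order \<alpha>)))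
          * weight_root M (mi_order \<alpha>)) ^ mi_order \<alpha>)))"
      by (rule E_class_on_local_bound[OF p k M H b U f \<Omega>])
    then obtain C \<rho> where "0 < C" "0 < \<rho>"
      and bd: "\<And>\<alpha>. Lp_norm p \<Omega> (mi_deriv \<alpha> f)
        \<le> ennreal (C * (E * (H * \<rho> + \<beta> * (real (mi_order \<alpha>) / weight_root M (mi_order \<alpha>)))
          * weight_root M (mi_order \<alpha>)) ^ mi_order \<alpha>)"
      unfolding dc_bound.simps by blast
    note E = E\<beta> this(1,2)
    have D0: "0 \<le> D" using D[of 0] by simp
    define R where "R = E * (H * \<rho> + \<beta> * D)"
    have "R > 0" using E H(1) D0 by (auto simp: R_def intro!: mult_pos_pos add_pos_nonneg)
    have "Lp_norm p \<Omega> (mi_deriv \<alpha> f) \<le> ennreal (C * (R * weight_root M (mi_order \<alpha>)) ^ mi_order \<alpha>)" for \<alpha>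
    proof (rule order_trans[OF bd], intro ennreal_leI mult_left_mono power_mono mult_right_mono)
      show "E * (H * \<rho> + \<beta> * (real (mi_order \<alpha>) / weight_root M (mi_order \<alpha>))) \<le> R"
        unfolding R_def using E D by (intro mult_left_mono add_left_mono) auto
    qed (use E H(1) m in \<open>auto simp: less_imp_le intro!: mult_nonneg_nonneg add_nonneg_nonneg\<close>)
    then show ?thesis using \<open>R > 0\<close> E(3) unfolding Max_mi_order_le_iff by blast
  qed
  then show "f \<in> E_class Roumieu M p U" using f by (simp add: E_class_on_def)
qed

text \<open>
  Orders \<open>q\<close> for which \<open>q / m\<close> is small are covered by the choice of
  \<open>\<rho>\<close>. For the finitely many remaining orders the same estimate holds with a
  larger ratio, which is absorbed into the constant.
\<close>
lemma E_class_on_Beurling: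
  assumes p: "1 \<le> p" and k: "base_sequence k" and M: "weight_sequence M"
    and H: "1 \<le> H" "\<And>j. weight_root M (k (Suc j)) \<le> H * weight_root M (k j)"
    and b: "\<forall>j. \<forall>q\<ge>1. k j \<le> q \<longrightarrow> k (Suc j) \<le> b * q"
    and U: "open U" and lim: "(\<lambda>q. real q / weight_root M q) \<longlonglongrightarrow> 0"
  shows "(E_class_on (range k) Beurling M p U :: (real^'n::finite \<Rightarrow> complex) set) = E_class Beurling M p U"
proof (rule antisym[OF _ E_class_subset], rule subsetI)
  fix f :: "real^'n \<Rightarrow> complex" assume f: "f \<in> E_class_on (range k) Beurling M p U"
  note m = weight_root_pos[OF M]
  define x where "x q = real q / weight_root M q" for q
  have x0: "0 \<le> x q" for q using m[of q] by (simp add: x_def)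
  obtain D where D: "\<And>q. x q \<le> D"
  proof -
    have "Bseq x" using lim by (intro convergent_imp_Bseq convergentI) (simp add: x_def[abs_def])
    then obtain D where "\<And>q. norm (x q) \<le> D" unfolding Bseq_def by blast
    then show thesis using that[of D] by (auto simp: abs_le_iff)
  qed
  have "\<exists>C>0. \<forall>q\<in>UNIV. Max {Lp_norm p \<Omega> (mi_deriv \<alpha> f) | \<alpha>. mi_order \<alpha> = q}
      \<le> ennreal (C * (\<sigma> * weight_root M q) ^ q)"
    if \<Omega>: "open \<Omega>" "compact (closure \<Omega>)" "closure \<Omega> \<subseteq> U" and \<sigma>: "0 < \<sigma>" for \<Omega> \<sigma>
  proof -
    obtain E \<beta> where E: "0 < E" "0 \<le> \<beta>"
      and dc: "dc_bound Beurling (\<lambda>C \<rho>. 0 < C \<and> 0 < \<rho> \<longrightarrow> (\<forall>\<alpha>. Lp_norm p \<Omega> (mi_deriv \<alpha> f)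
        \<le> ennreal (C * (E * (H * \<rho> + \<beta> * x (mi_order \<alpha>)) * weight_root M (mi_order \<alpha>)) ^ mi_order \<alpha>)))"
      unfolding x_def by (rule E_class_on_local_bound[OF p k M H b U f \<Omega>])
    define \<rho> where "\<rho> = \<sigma> / (2 * E * H)"
    have \<rho>: "0 < \<rho>" "E * (H * \<rho>) = \<sigma> / 2" using \<sigma> E H(1) by (auto simp: \<rho>_def)
    obtain C where C: "0 < C" and bd: "\<And>\<alpha>. Lp_norm p \<Omega> (mi_deriv \<alpha> f)
        \<le> ennreal (C * (E * (H * \<rho> + \<beta> * x (mi_order \<alpha>)) * weight_root M (mi_order \<alpha>)) ^ mi_order \<alpha>)"
      using dc[unfolded dc_bound.simps, rule_format, OF \<rho>(1)] \<rho>(1) by blast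
    have "(\<lambda>q. E * (\<beta> * x q)) \<longlonglongrightarrow> E * (\<beta> * 0)"
      unfolding x_def by (intro tendsto_intros lim)
    then have "\<forall>\<^sub>F q in sequentially. E * (\<beta> * x q) < \<sigma> / 2"
      using \<sigma> by (intro order_tendstoD(2)) auto
    then obtain q0 where q0: "\<And>q. q0 \<le> q \<Longrightarrow> E * (\<beta> * x q) < \<sigma> / 2"
      unfolding eventually_sequentially by blast
    \<comment> \<open>The factor by which the ratio may exceed \<open>\<sigma>\<close> at the orders below \<open>q0\<close>.\<close>
    define R where "R = max 1 (E * (H * \<rho> + \<beta> * D) / \<sigma>)"
    have R: "1 \<le> R" "E * (H * \<rho> + \<beta> * D) \<le> R * \<sigma>"
      using \<sigma> by (auto simp: R_def max_def field_simps)
    have key: "(E * (H * \<rho> + \<beta> * x q) * weight_root M q) ^ q \<le> R ^ q0 * (\<sigma> * weight_root M q) ^ q" for q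
    proof (cases "q0 \<le> q")
      case True
      have "E * (H * \<rho> + \<beta> * x q) \<le> \<sigma>" using q0[OF True] \<rho>(2) by (simp add: distrib_left)
      then have "(E * (H * \<rho> + \<beta> * x q) * weight_root M q) ^ q \<le> (\<sigma> * weight_root M q) ^ q"
        using E H(1) \<rho>(1) x0 m[of q] by (intro power_mono mult_right_mono) auto
      also have "\<dots> = 1 * (\<sigma> * weight_root M q) ^ q" by simp
      also have "\<dots> \<le> R ^ q0 * (\<sigma> * weight_root M q) ^ q"
        using R(1) \<sigma> m[of q] by (intro mult_right_mono one_le_power) auto
      finally show ?thesis .
    next
      case False
      have "E * (H * \<rho> + \<beta> * x q) \<le> E * (H * \<rho> + \<beta> * D)"
        using E D by (intro mult_left_mono add_left_mono) auto
      also note R(2)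
      finally have "(E * (H * \<rho> + \<beta> * x q) * weight_root M q) ^ q \<le> (R * \<sigma> * weight_root M q) ^ q"
        using E H(1) \<rho>(1) x0 m[of q] by (intro power_mono mult_right_mono) auto
      also have "\<dots> = R ^ q * (\<sigma> * weight_root M q) ^ q" by (simp add: power_mult_distrib)
      also have "\<dots> \<le> R ^ q0 * (\<sigma> * weight_root M q) ^ q"
        using R(1) \<sigma> m[of q] False by (intro mult_right_mono power_increasing) auto
      finally show ?thesis .
    qed
    have "Lp_norm p \<Omega> (mi_deriv \<alpha> f)
        \<le> ennreal ((C * R ^ q0) * (\<sigma> * weight_root M (mi_order \<alpha>)) ^ mi_order \<alpha>)" for \<alpha>
      using key[of "mi_order \<alpha>"] C
      by (intro order_trans[OF bd] ennreal_leI) (simp add: mult.assoc)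
    moreover have "0 < C * R ^ q0" using C R(1) by simp
    ultimately show ?thesis unfolding Max_mi_order_le_iff by blast
  qed
  then show "f \<in> E_class Beurling M p U" using f by (simp add: E_class_on_def)
qed

theorem theorem4p1:
  fixes p :: ennreal and k :: "nat \<Rightarrow> nat" and M :: "nat \<Rightarrow> real"
  assumes "1 \<le> p"
    and "base_sequence k"
    and "weight_sequence M"
    and "bdd_above (range (\<lambda>j. weight_root M (k (Suc j)) / weight_root M (k j)))"
  shows "(\<forall>t. (B_class_on (range k) t M p :: (real^'n::finite \<Rightarrow> complex) set) = B_class t M p)
    \<and> (\<forall>t. (D_class_on (range k) t M :: (real^'n \<Rightarrow> complex) set) = D_class t M)
    \<and> (special_base_sequence k \<longrightarrow>
         (\<forall>U :: (real^'n) set. open U \<longrightarrow>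
            (bdd_above (range (\<lambda>j. real j / weight_root M j)) \<longrightarrow>
               E_class_on (range k) Roumieu M p U = E_class Roumieu M p U)
          \<and> ((\<lambda>j. real j / weight_root M j) \<longlonglongrightarrow> 0 \<longrightarrow>
               E_class_on (range k) Beurling M p U = E_class Beurling M p U)))"
proof -
  obtain H0 where H0: "\<And>j. weight_root M (k (Suc j)) / weight_root M (k j) \<le> H0"
    using assms(4) unfolding bdd_above_def by auto
  define H where "H = max 1 H0"
  have H: "1 \<le> H" "weight_root M (k (Suc j)) \<le> H * weight_root M (k j)" for j
  proof -
    have "weight_root M (k (Suc j)) / weight_root M (k j) \<le> H" using H0[of j] by (simp add: H_def)
    then show "weight_root M (k (Suc j)) \<le> H * weight_root M (k j)"
      using weight_root_pos[OF assms(3), of "k j"] by (simp add: field_simps)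
  qed (simp add: H_def)
  have B: "(B_class_on (range k) t M r :: (real^'n::finite \<Rightarrow> complex) set) = B_class t M r"
    if "1 \<le> r" for t r
    by (rule B_class_on_base_sequence[OF that assms(2,3) H])
  have D: "(D_class_on (range k) t M :: (real^'n \<Rightarrow> complex) set) = D_class t M" for t
    unfolding D_class_on_def by (simp add: B)
  have E: "(bdd_above (range (\<lambda>j. real j / weight_root M j)) \<longrightarrow>
               E_class_on (range k) Roumieu M p U = E_class Roumieu M p U)
          \<and> ((\<lambda>j. real j / weight_root M j) \<longlonglongrightarrow> 0 \<longrightarrow>
               E_class_on (range k) Beurling M p U = E_class Beurling M p U)"
    if special: "special_base_sequence k" and U: "open U" for U :: "(real^'n) set"
  proof (intro conjI impI)
    obtain b where b: "\<forall>j. \<forall>q\<ge>1. k j \<le> q \<longrightarrow> k (Suc j) \<le> b * q"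
      using special_base_sequence_step[OF special] by blast
    note hyps = assms(1-3) H b U
    show "E_class_on (range k) Roumieu M p U = E_class Roumieu M p U"
      if bdd: "bdd_above (range (\<lambda>j. real j / weight_root M j))"
    proof -
      obtain D where "\<And>j. real j / weight_root M j \<le> D"
        using bdd unfolding bdd_above_def by auto
      then show ?thesis by (rule E_class_on_Roumieu[OF hyps])
    qed
    show "E_class_on (range k) Beurling M p U = E_class Beurling M p U"
      if "(\<lambda>j. real j / weight_root M j) \<longlonglongrightarrow> 0"
      using that by (rule E_class_on_Beurling[OF hyps])
  qed
  show ?thesis
    by (intro conjI[OF allI conjI[OF allI]] impI allI B[OF assms(1)] D E)
qed

end
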